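(* Fix an integer $k \geq 2$. There exists $N = N(k)$ such that for every $n \geq N$ the following holds: if $\mathcal{F} \subseteq \mathcal{M}_{kn}^k$ is a partially 2-intersecting family of maximum possible size (i.e., no partially 2-intersecting subfamily of $\mathcal{M}_{kn}^k$ is larger), then $\mathcal{F}$ is canonically partially 2-intersecting, i.e., $\mathcal{F} = \mathcal{F}_{ij}$ for some 2-element subset $\{i,j\} \subseteq [kn]$.
   Context: $K_{kn}^k$ denotes the complete $k$-uniform hypergraph on vertex set $[kn]=\{1,\dots,kn\}$, and $\mathcal{M}_{kn}^k$ is the set of its perfect hypermatchings, i.e., partitions of $[kn]$ into $n$ blocks ($k$-edges) of size $k$. Two perfect hypermatchings $m,m'$ partially 2-intersect if there exist $k$-edges $e \in m$, $e' \in m'$ with $|e \cap e'| \geq 2$. A family $\mathcal{F} \subseteq \mathcal{M}_{kn}^k$ is partially 2-intersecting if every two of its members partially 2-intersect. For a 2-set $\{i,j\} \subseteq [kn]$, $\mathcal{F}_{ij} = \{ m \in \mathcal{M}_{kn}^k : \{i,j\} \subseteq e \text{ for some } e \in m\}$; these are the canonically partially 2-intersecting families. *)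

theory Defs
  imports "HOL-Library.Disjoint_Sets"
begin

definition perfect_hypermatchings :: "nat \<Rightarrow> nat \<Rightarrow> nat set set set" where
  "perfect_hypermatchings k n =
     {m. partition_on {1..k * n} m \<and> card m = n \<and> (\<forall>e\<in>m. card e = k)}"

definition partially_2_intersect :: "nat set set \<Rightarrow> nat set set \<Rightarrow> bool" where
  "partially_2_intersect m m' \<longleftrightarrow> (\<exists>e\<in>m. \<exists>e'\<in>m'. card (e \<inter> e') \<ge> 2)"

text \<open>The two members need not be distinct below. This adds nothing for \<open>k \<ge> 2\<close> and
  \<open>n \<ge> 1\<close>, where every perfect hypermatching partially 2-intersects itself.\<close>

definition partially_2_intersecting :: "nat \<Rightarrow> nat \<Rightarrow> nat set set set \<Rightarrow> bool" where
  "partially_2_intersecting k n F \<longleftrightarrow>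
     F \<subseteq> perfect_hypermatchings k n \<and> (\<forall>m\<in>F. \<forall>m'\<in>F. partially_2_intersect m m')"

definition canonical_family :: "nat \<Rightarrow> nat \<Rightarrow> nat \<Rightarrow> nat \<Rightarrow> nat set set set" where
  "canonical_family k n i j = {m \<in> perfect_hypermatchings k n. \<exists>e\<in>m. {i, j} \<subseteq> e}"

end

theory Submission
  imports Defs "HOL-Combinatorics.Permutations" "HOL-Library.Indicator_Function"
    "HOL-Analysis.Convex" "HOL-Real_Asymp.Real_Asymp"
begin

text \<open>Two perfect hypermatchings fail to partially 2-intersect iff they are \<^emph>\<open>skew\<close>: no two
  points are block mates in both. A switching argument shows that, for fixed \<open>k\<close>, a positive
  fraction of all hypermatchings is skew to a given one. Let \<open>F\<close> be a largest intersecting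
  family, so that its density is of order \<open>1/n\<close> at least.

  Counting the members of \<open>F\<close> skew to \<open>x\<close> gives a function \<open>h\<close> of \<open>x\<close> that vanishes on \<open>F\<close>,
  while its mean has the order of \<open>|F|\<close>. Transposing two points changes \<open>h\<close> only through members
  of \<open>F\<close> in \<open>O(k)\<close> canonical families. If each canonical family met \<open>F\<close> in only a small fraction
  of \<open>F\<close>, concentration of measure on the symmetric group would make \<open>h = 0\<close> less likely than
  \<open>1/n\<close>. Hence some pair \<open>{a, b}\<close> is contained in a block of a fraction at least
  \<open>1 / (sqrt n * log n)\<close>, up to a constant, of the members of \<open>F\<close>.

  The members of \<open>F\<close> with \<open>a\<close>, \<open>b\<close> together and those with \<open>a\<close>, \<open>b\<close> apart are cross-intersecting.
  The bipartite skewness graph between the two classes of hypermatchings has its nontrivial singular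
  values bounded by \<open>O(1/n)\<close>: averaging over skew partners contracts the Lipschitz constant
  with respect to transpositions by this factor. An expander-mixing estimate then makes the second
  part of \<open>F\<close> negligible. A single member \<open>x\<close> of the second part would exclude from \<open>F\<close> the positive
  fraction of the canonical family of \<open>{a, b}\<close> that is skew to \<open>x\<close>, contradicting maximality.\<close>

section \<open>Concentration of measure on the symmetric group\<close>

text \<open>For negative \<open>x\<close> the bound comes from inverting the Taylor lower bound of
  \<open>exp (- x)\<close>. The linear term is kept exact so that it cancels when summed over
  deviations from a mean.\<close>

lemma exp_le_quadratic:
  fixes x :: real assumes "\<bar>x\<bar> \<le> 1" shows "exp x \<le> 1 + x + x\<^sup>2"
proof (cases "x \<ge> 0")
  case True
  then show ?thesis using exp_bound[of x] assms by simp
next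
  case False
  have "1 / (1 + (-x) + (-x)\<^sup>2 / 2) \<ge> 1 / exp (- x)"
    using exp_lower_Taylor_quadratic[of "-x"] False
    by (intro divide_left_mono mult_pos_pos) (auto intro: add_pos_nonneg)
  then have "exp x \<le> 1 / (1 - x + x\<^sup>2 / 2)" by (simp add: exp_minus field_simps)
  also have "\<dots> \<le> 1 + x + x\<^sup>2"
  proof -
    have "1 - x + x\<^sup>2 / 2 > 0" using False by (intro add_pos_nonneg) auto
    moreover have "(1 + x + x\<^sup>2) * (1 - x + x\<^sup>2 / 2) = 1 + x\<^sup>2 / 2 * (1 - x + x\<^sup>2)"
      by (simp add: field_simps power2_eq_square)
    moreover have "x\<^sup>2 / 2 * (1 - x + x\<^sup>2) \<ge> 0" using False by (intro mult_nonneg_nonneg) auto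
    ultimately show ?thesis by (simp add: pos_divide_le_eq)
  qed
  finally show ?thesis .
qed

text \<open>Martingale argument by induction on \<open>A\<close>: a permutation of
  \<open>insert a A\<close> is uniquely \<open>transpose a b\<close> composed with a permutation
  fixing \<open>a\<close>, and \<open>b\<close> is the image of \<open>a\<close>. The conditional
  means given \<open>b\<close> deviate from \<open>\<mu>\<close> by at most \<open>2 * l\<close> and
  these deviations sum to zero, so revealing \<open>b\<close> costs only a factor
  \<open>1 + 4 * l\<^sup>2\<close>.\<close>

lemma permutation_concentration:
  fixes h :: "('a \<Rightarrow> 'a) \<Rightarrow> real"
  assumes "finite A"
    and "\<And>\<sigma> u v. \<sigma> permutes A \<Longrightarrow> u \<in> A \<Longrightarrow> v \<in> A \<Longrightarrow> \<bar>h (transpose u v \<circ> \<sigma>) - h \<sigma>\<bar> \<le> l"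
    and "(\<Sum>\<sigma> | \<sigma> permutes A. h \<sigma>) = fact (card A) * \<mu>"
    and "0 \<le> l" "2 * l \<le> 1"
  shows "(\<Sum>\<sigma> | \<sigma> permutes A. exp (h \<sigma> - \<mu>)) \<le> fact (card A) * exp (4 * l\<^sup>2 * card A)"
  using assms
proof (induction A arbitrary: h \<mu> rule: finite_induct)
  case empty
  then show ?case by simp
next
  case (insert a A)
  define P where "P = {\<pi>. \<pi> permutes A}"
  define f where "f = (fact (card A) :: real)"
  have f: "f > 0" by (simp add: f_def)
  have cardP: "card P = fact (card A)" unfolding P_def using insert by (intro card_permutations) auto
  define g where "g b \<pi> = h (transpose a b \<circ> \<pi>)" for b \<pi>
  define c where "c b = (\<Sum>\<pi>\<in>P. g b \<pi>) / f" for b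
  \<comment> \<open>The mean of \<open>h\<close> over the permutations fixing \<open>a\<close> is a
    common reference for all \<open>c b\<close>, since \<open>g b \<pi>\<close> and
    \<open>h \<pi>\<close> differ by one transposition.\<close>
  define d where "d = (\<Sum>\<pi>\<in>P. h \<pi>) / f"
  have perm: "\<pi> permutes insert a A" if "\<pi> permutes A" for \<pi>
    using that by (rule permutes_subset) auto
  have split: "sum F {\<sigma>. \<sigma> permutes insert a A} = (\<Sum>b\<in>insert a A. \<Sum>\<pi>\<in>P. F (transpose a b \<circ> \<pi>))"
    for F :: "('a \<Rightarrow> 'a) \<Rightarrow> real"
    unfolding P_def using insert.hyps by (intro sum_over_permutations_insert) auto
  have fact_eq: "fact (card (insert a A)) = f * card (insert a A)"
    using insert.hyps by (simp add: f_def)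
  have sum_c: "(\<Sum>b\<in>insert a A. c b) = card (insert a A) * \<mu>"
  proof -
    have "(\<Sum>b\<in>insert a A. c b) = (\<Sum>\<sigma> | \<sigma> permutes insert a A. h \<sigma>) / f"
      unfolding split c_def g_def by (rule sum_divide_distrib[symmetric])
    also have "\<dots> = card (insert a A) * \<mu>" unfolding insert.prems(2) fact_eq using f by simp
    finally show ?thesis .
  qed
  have c_d: "\<bar>c b - d\<bar> \<le> l" if b: "b \<in> insert a A" for b
  proof -
    have "\<bar>c b - d\<bar> = \<bar>\<Sum>\<pi>\<in>P. g b \<pi> - h \<pi>\<bar> / f"
      unfolding c_def d_def using f by (simp add: diff_divide_distrib[symmetric] sum_subtractf)
    also have "\<bar>\<Sum>\<pi>\<in>P. g b \<pi> - h \<pi>\<bar> \<le> (\<Sum>\<pi>\<in>P. l)"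
      unfolding g_def
      by (rule order.trans[OF sum_abs], intro sum_mono insert.prems(1)) (use b perm P_def in auto)
    also have "\<dots> = l * f" by (simp add: cardP f_def)
    finally show ?thesis using f by (simp add: divide_right_mono)
  qed
  have c_mu: "\<bar>c b - \<mu>\<bar> \<le> 2 * l" if b: "b \<in> insert a A" for b
  proof -
    have n: "real (card (insert a A)) > 0" using insert.hyps by simp
    have "(\<Sum>b\<in>insert a A. c b - d) = real (card (insert a A)) * (\<mu> - d)"
      by (simp only: sum_subtractf sum_c sum_constant right_diff_distrib)
    then have "real (card (insert a A)) * \<bar>\<mu> - d\<bar> = \<bar>\<Sum>b\<in>insert a A. c b - d\<bar>"
      by (simp only: abs_mult abs_of_nat)
    also have "\<dots> \<le> (\<Sum>b\<in>insert a A. l)" by (rule order.trans[OF sum_abs], intro sum_mono c_d)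
    also have "\<dots> = real (card (insert a A)) * l" by simp
    finally have "\<bar>\<mu> - d\<bar> \<le> l" using n by (simp only: mult_le_cancel_left_pos)
    then show ?thesis using c_d[OF b] by linarith
  qed
  have IH: "(\<Sum>\<pi>\<in>P. exp (g b \<pi> - c b)) \<le> f * exp (4 * l\<^sup>2 * card A)" if b: "b \<in> insert a A" for b
    unfolding P_def f_def
  proof (rule insert.IH)
    fix \<pi> u v assume \<pi>: "\<pi> permutes A" and uv: "u \<in> A" "v \<in> A"
    let ?t = "transpose a b"
    \<comment> \<open>Conjugation by \<open>?t\<close> turns a transposition into another
      transposition, so \<open>g b\<close> inherits the bound \<open>l\<close>.\<close>
    have eq: "?t \<circ> (transpose u v \<circ> \<pi>) = transpose (?t u) (?t v) \<circ> (?t \<circ> \<pi>)"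
      by (auto simp: fun_eq_iff transpose_def)
    have "?t permutes insert a A" using b by (intro permutes_swap_id) auto
    then have "(?t \<circ> \<pi>) permutes insert a A" using perm[OF \<pi>] by (intro permutes_compose)
    moreover have "?t u \<in> insert a A" "?t v \<in> insert a A" using uv b by (auto simp: transpose_def)
    ultimately show "\<bar>g b (transpose u v \<circ> \<pi>) - g b \<pi>\<bar> \<le> l"
      unfolding g_def eq by (intro insert.prems(1))
  next
    show "(\<Sum>\<pi> | \<pi> permutes A. g b \<pi>) = fact (card A) * c b" by (simp add: c_def f_def P_def)
  qed (use insert.prems in auto)
  have "(\<Sum>\<sigma> | \<sigma> permutes insert a A. exp (h \<sigma> - \<mu>))
      = (\<Sum>b\<in>insert a A. exp (c b - \<mu>) * (\<Sum>\<pi>\<in>P. exp (g b \<pi> - c b)))"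
    unfolding split g_def sum_distrib_left by (simp flip: exp_add)
  also have "\<dots> \<le> (\<Sum>b\<in>insert a A. exp (c b - \<mu>) * (f * exp (4 * l\<^sup>2 * card A)))"
    by (intro sum_mono mult_left_mono IH) auto
  also have "\<dots> = f * exp (4 * l\<^sup>2 * card A) * (\<Sum>b\<in>insert a A. exp (c b - \<mu>))"
    by (subst sum_distrib_right[symmetric]) (rule mult.commute)
  also have "\<dots> \<le> f * exp (4 * l\<^sup>2 * card A) * (\<Sum>b\<in>insert a A. 1 + (c b - \<mu>) + (2 * l)\<^sup>2)"
  proof (intro mult_left_mono sum_mono)
    fix b assume b: "b \<in> insert a A"
    have "exp (c b - \<mu>) \<le> 1 + (c b - \<mu>) + (c b - \<mu>)\<^sup>2"
      by (rule exp_le_quadratic) (use c_mu[OF b] insert.prems in linarith)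
    moreover have "(c b - \<mu>)\<^sup>2 \<le> (2 * l)\<^sup>2"
      using c_mu[OF b] insert.prems by (intro power2_le_iff_abs_le[THEN iffD2]) auto
    ultimately show "exp (c b - \<mu>) \<le> 1 + (c b - \<mu>) + (2 * l)\<^sup>2" by linarith
  qed (use f in auto)
  also have "(\<Sum>b\<in>insert a A. 1 + (c b - \<mu>) + (2 * l)\<^sup>2) = card (insert a A) * (1 + 4 * l\<^sup>2)"
    unfolding sum.distrib sum_subtractf sum_c by (simp add: algebra_simps power2_eq_square)
  also have "f * exp (4 * l\<^sup>2 * card A) * (card (insert a A) * (1 + 4 * l\<^sup>2))
     \<le> f * exp (4 * l\<^sup>2 * card A) * (card (insert a A) * exp (4 * l\<^sup>2))"
    using f by (intro mult_left_mono exp_ge_add_one_self) auto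
  also have "\<dots> = fact (card (insert a A)) * exp (4 * l\<^sup>2 * card (insert a A))"
    unfolding fact_eq using insert.hyps by (simp add: algebra_simps exp_add)
  finally show ?case .
qed

section \<open>Cross-independent sets in bipartite graphs\<close>

text \<open>The involution \<open>P\<close> exchanges \<open>S - S'\<close> and
  \<open>S' - S\<close>, and the common part cancels. What remains is a sum of differences
  \<open>u x - u (P x)\<close> over at most \<open>\<kappa> * d\<close> points.\<close>

lemma averaging_contracts:
  fixes u :: "'a \<Rightarrow> real"
  assumes "finite X"
    and P: "\<And>x. x \<in> X \<Longrightarrow> P x \<in> X" "\<And>x. x \<in> X \<Longrightarrow> P (P x) = x"
    and S: "S \<subseteq> X" "S' \<subseteq> X" "\<And>x. x \<in> X \<Longrightarrow> P x \<in> S' \<longleftrightarrow> x \<in> S"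
    and "real (card (S - S')) \<le> \<kappa> * d" "d > 0"
    and L: "\<And>x. x \<in> X \<Longrightarrow> \<bar>u x - u (P x)\<bar> \<le> L" "L \<ge> 0"
  shows "\<bar>sum u S / d - sum u S' / d\<bar> \<le> \<kappa> * L"
proof -
  have fin: "finite S" "finite S'" using S assms(1) by (auto intro: finite_subset)
  have "sum u S = sum u (S - S') + sum u (S \<inter> S')" "sum u S' = sum u (S' - S) + sum u (S \<inter> S')"
    using sum.Int_Diff[OF fin(1), of u S'] sum.Int_Diff[OF fin(2), of u S]
    by (simp_all add: Int_commute)
  moreover have "sum u (S' - S) = (\<Sum>x\<in>S - S'. u (P x))"
  proof (rule sum.reindex_bij_witness[where i = P and j = P])
    fix x assume "x \<in> S' - S"
    then show "P x \<in> S - S'" "P (P x) = x" using P S by (metis Diff_iff subsetD)+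
  next
    fix x assume "x \<in> S - S'"
    then show "P x \<in> S' - S" "P (P x) = x" using P S by (metis Diff_iff subsetD)+
  qed (use P S in auto)
  ultimately have "sum u S - sum u S' = (\<Sum>x\<in>S - S'. u x - u (P x))"
    by (simp add: sum_subtractf)
  also have "\<bar>\<dots>\<bar> \<le> (\<Sum>x\<in>S - S'. L)"
    by (rule order.trans[OF sum_abs], intro sum_mono L) (use S in auto)
  also have "\<dots> \<le> \<kappa> * d * L" using assms by (simp add: mult_right_mono)
  finally have "\<bar>sum u S - sum u S'\<bar> / d \<le> \<kappa> * L"
    using \<open>d > 0\<close> by (simp add: pos_divide_le_eq algebra_simps)
  then show ?thesis using \<open>d > 0\<close> by (simp flip: diff_divide_distrib)
qed

text \<open>Log-convexity makes the ratios of consecutive terms nondecreasing. A first ratio above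
  \<open>r\<close> would thus force growth faster than \<open>K * r ^ s\<close>.\<close>

lemma log_convex_geometric:
  fixes b :: "nat \<Rightarrow> real"
  assumes pos: "\<And>s. b s \<ge> 0" and conv: "\<And>s. (b (Suc s))\<^sup>2 \<le> b s * b (Suc (Suc s))"
    and bound: "\<And>s. b s \<le> K * r ^ s" and "r > 0"
  shows "b 1 \<le> r * b 0"
proof (rule ccontr)
  assume "\<not> b 1 \<le> r * b 0"
  then have gt: "b 1 > r * b 0" by simp
  have b0: "b 0 > 0"
  proof (rule ccontr)
    assume "\<not> b 0 > 0"
    then have "b 0 = 0" using pos[of 0] by simp
    then show False using conv[of 0] gt by simp
  qed
  define \<rho> where "\<rho> = b 1 / b 0"
  have \<rho>: "\<rho> > r" using gt b0 by (simp add: \<rho>_def pos_less_divide_eq)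
  have step: "b s > 0 \<and> b (Suc s) \<ge> \<rho> * b s" for s
  proof (induction s)
    case 0
    then show ?case using b0 by (simp add: \<rho>_def)
  next
    case (Suc s)
    have pos': "b (Suc s) > 0"
      using Suc \<rho> \<open>r > 0\<close> by (meson less_le_trans mult_pos_pos order_less_trans)
    have "\<rho> * b s * b (Suc s) \<le> b (Suc s) * b (Suc s)"
      using Suc pos' by (intro mult_right_mono) auto
    also have "\<dots> \<le> b s * b (Suc (Suc s))" using conv[of s] by (simp add: power2_eq_square)
    finally have "\<rho> * b (Suc s) \<le> b (Suc (Suc s))" using Suc by (simp add: mult.assoc mult.left_commute)
    then show ?case using pos' by simp
  qed
  have lower: "\<rho> ^ s * b 0 \<le> b s" for s
  proof (induction s)
    case (Suc s)
    have "\<rho> ^ Suc s * b 0 \<le> \<rho> * b s"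
      using Suc \<rho> \<open>r > 0\<close> by (simp add: mult.assoc mult_left_mono)
    then show ?case using step[of s] by linarith
  qed simp
  have "(\<rho> / r) ^ s \<le> K / b 0" for s
    using order.trans[OF lower bound, of s] b0 \<open>r > 0\<close>
    by (simp add: power_divide field_simps)
  moreover have "\<rho> / r > 1" using \<rho> \<open>r > 0\<close> by simp
  ultimately show False using real_arch_pow[of "\<rho> / r" "K / b 0"] by (meson not_less)
qed

text \<open>The number \<open>m\<close> is fixed before \<open>u\<close> and \<open>L\<close>; it
  reflects only the lengths of paths in the finite set \<open>X\<close>. One \<open>m\<close>
  therefore serves all iterates of an operator.\<close>

lemma Lipschitz_bound_along_moves:
  fixes X :: "'a set"
  assumes "finite X"
    and conn: "\<And>x x'. x \<in> X \<Longrightarrow> x' \<in> X \<Longrightarrow> (x, x') \<in> {(x, p i x) |x i. x \<in> X \<and> i \<in> I}\<^sup>*"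
  obtains m :: nat where "\<And>u :: 'a \<Rightarrow> real. \<And>L x x'. (\<And>x i. x \<in> X \<Longrightarrow> i \<in> I \<Longrightarrow> \<bar>u x - u (p i x)\<bar> \<le> L)
    \<Longrightarrow> x \<in> X \<Longrightarrow> x' \<in> X \<Longrightarrow> L \<ge> 0 \<Longrightarrow> \<bar>u x - u x'\<bar> \<le> real m * L"
proof -
  let ?R = "{(x, p i x) |x i. x \<in> X \<and> i \<in> I}"
  define lip where "lip u L \<longleftrightarrow> (\<forall>x\<in>X. \<forall>i\<in>I. \<bar>u x - u (p i x)\<bar> \<le> L)" for u :: "'a \<Rightarrow> real" and L
  have path: "\<exists>m::nat. \<forall>u L. lip u L \<longrightarrow> \<bar>u x - u x'\<bar> \<le> m * L" if "(x, x') \<in> ?R\<^sup>*" for x x'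
    using that
  proof (induction rule: rtrancl_induct)
    case base
    then show ?case by (intro exI[of _ 0]) auto
  next
    case (step y z)
    then obtain m :: nat where m: "\<And>u L. lip u L \<Longrightarrow> \<bar>u x - u y\<bar> \<le> real m * L" by blast
    have "\<bar>u x - u z\<bar> \<le> real (Suc m) * L" if "lip u L" for u L
    proof -
      have "\<bar>u y - u z\<bar> \<le> L" using that step(2) by (auto simp: lip_def)
      then show ?thesis using m[OF that] by (simp add: distrib_right)
    qed
    then show ?case by blast
  qed
  define m where "m x x' = (SOME m::nat. \<forall>u L. lip u L \<longrightarrow> \<bar>u x - u x'\<bar> \<le> m * L)" for x x'
  have m: "\<bar>u x - u x'\<bar> \<le> real (m x x') * L" if "x \<in> X" "x' \<in> X" "lip u L" for x x' u L
    using someI_ex[OF path[OF conn[OF that(1,2)]]] that(3) unfolding m_def by blast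
  \<comment> \<open>The sum over all pairs is a crude common upper bound for the finitely many path
    bounds.\<close>
  define S where "S = (\<Sum>x\<in>X. \<Sum>x'\<in>X. m x x')"
  have bnd: "\<bar>u x - u x'\<bar> \<le> real S * L"
    if "x \<in> X" "x' \<in> X" "lip u L" "L \<ge> 0" for x x' u L
  proof -
    have "m x x' \<le> (\<Sum>x'\<in>X. m x x')" using that assms(1) by (intro member_le_sum) auto
    also have "\<dots> \<le> S"
      unfolding S_def using that assms(1) by (intro member_le_sum[where f = "\<lambda>x. \<Sum>x'\<in>X. m x x'"]) auto
    finally have "real (m x x') * L \<le> real S * L"
      using that(4) by (intro mult_right_mono) auto
    then show ?thesis using m[OF that(1-3)] by linarith
  qed
  show ?thesis
  proof (rule that)
    fix u :: "'a \<Rightarrow> real" and L x x'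
    assume "\<And>x i. x \<in> X \<Longrightarrow> i \<in> I \<Longrightarrow> \<bar>u x - u (p i x)\<bar> \<le> L" "x \<in> X" "x' \<in> X" "L \<ge> 0"
    then show "\<bar>u x - u x'\<bar> \<le> real S * L"
      by (intro bnd) (auto simp: lip_def)
  qed
qed

text \<open>The averaging operators \<open>A\<close> and \<open>B\<close> are adjoint up to scaling and multiply Lipschitz constants
  by at most \<open>\<kappa>\<close>, so the iterates of \<open>B \<circ> A\<close> on a function of mean zero decay like \<open>\<kappa> ^ (2 * s)\<close>.
  Since their \<open>L\<^sup>2\<close> norms are log-convex in \<open>s\<close>, the first step already shrinks the norm by \<open>\<kappa>\<^sup>2\<close>.
  No spectral theorem is needed.\<close>

lemma cross_independent_bound:
  fixes D :: "'a \<Rightarrow> 'b \<Rightarrow> bool" and p :: "'i \<Rightarrow> 'a \<Rightarrow> 'a" and q :: "'i \<Rightarrow> 'b \<Rightarrow> 'b" and \<kappa> :: real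
  assumes fin: "finite X" "finite Y" and ne: "X \<noteq> {}"
    and p: "\<And>i x. i \<in> I \<Longrightarrow> x \<in> X \<Longrightarrow> p i x \<in> X" "\<And>i x. i \<in> I \<Longrightarrow> x \<in> X \<Longrightarrow> p i (p i x) = x"
    and q: "\<And>i y. i \<in> I \<Longrightarrow> y \<in> Y \<Longrightarrow> q i y \<in> Y" "\<And>i y. i \<in> I \<Longrightarrow> y \<in> Y \<Longrightarrow> q i (q i y) = y"
    and D: "\<And>i x y. i \<in> I \<Longrightarrow> x \<in> X \<Longrightarrow> y \<in> Y \<Longrightarrow> D (p i x) y \<longleftrightarrow> D x (q i y)"
    and degX: "\<And>x. x \<in> X \<Longrightarrow> card {y\<in>Y. D x y} = dX" and degY: "\<And>y. y \<in> Y \<Longrightarrow> card {x\<in>X. D x y} = dY"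
    and dpos: "dX > 0" "dY > 0"
    and kX: "\<And>i x. i \<in> I \<Longrightarrow> x \<in> X \<Longrightarrow> real (card {y\<in>Y. D x y \<and> \<not> D (p i x) y}) \<le> \<kappa> * dX"
    and kY: "\<And>i y. i \<in> I \<Longrightarrow> y \<in> Y \<Longrightarrow> real (card {x\<in>X. D x y \<and> \<not> D x (q i y)}) \<le> \<kappa> * dY"
    and \<kappa>: "\<kappa> > 0"
    and conn: "\<And>x x'. x \<in> X \<Longrightarrow> x' \<in> X \<Longrightarrow> (x, x') \<in> {(x, p i x) |x i. x \<in> X \<and> i \<in> I}\<^sup>*"
    and f: "f \<subseteq> X" and g: "g \<subseteq> Y" and indep: "\<And>x y. x \<in> f \<Longrightarrow> y \<in> g \<Longrightarrow> \<not> D x y"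
  shows "real (card f) * card g \<le> \<kappa>\<^sup>2 * (card X * card Y)"
proof -
  define A where "A u y = (\<Sum>x | x \<in> X \<and> D x y. u x) / dY" for u :: "'a \<Rightarrow> real" and y
  define B where "B w x = (\<Sum>y | y \<in> Y \<and> D x y. w y) / dX" for w :: "'b \<Rightarrow> real" and x
  have adj: "dX * (\<Sum>x\<in>X. u x * B w x) = dY * (\<Sum>y\<in>Y. A u y * w y)" for u w
  proof -
    have "dX * (\<Sum>x\<in>X. u x * B w x) = (\<Sum>x\<in>X. \<Sum>y | y \<in> Y \<and> D x y. u x * w y)"
      unfolding sum_distrib_left
    proof (intro sum.cong refl)
      fix x assume "x \<in> X"
      have "dX * (u x * B w x) = u x * (\<Sum>y | y \<in> Y \<and> D x y. w y)" using dpos by (simp add: B_def)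
      then show "dX * (u x * B w x) = (\<Sum>y | y \<in> Y \<and> D x y. u x * w y)" by (simp only: sum_distrib_left)
    qed
    also have "\<dots> = (\<Sum>y\<in>Y. \<Sum>x | x \<in> X \<and> D x y. u x * w y)"
      by (rule sum.swap_restrict) (use fin in auto)
    also have "\<dots> = dY * (\<Sum>y\<in>Y. A u y * w y)"
      unfolding sum_distrib_left
    proof (intro sum.cong refl)
      fix y assume "y \<in> Y"
      have "dY * (A u y * w y) = (\<Sum>x | x \<in> X \<and> D x y. u x) * w y" using dpos by (simp add: A_def)
      then show "(\<Sum>x | x \<in> X \<and> D x y. u x * w y) = dY * (A u y * w y)" by (simp only: sum_distrib_right)
    qed
    finally show ?thesis .
  qed
  have A_const: "A (\<lambda>_. c) y = c" if "y \<in> Y" for c y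
    using degY[OF that] dpos by (simp add: A_def)
  have B_const: "B (\<lambda>_. c) x = c" if "x \<in> X" for c x
    using degX[OF that] dpos by (simp add: B_def)
  \<comment> \<open>Edges counted from both sides, read off from adjointness with constant
    functions.\<close>
  have count: "real dX * card X = real dY * card Y"
    using adj[of "\<lambda>_. 1" "\<lambda>_. 1"] by (simp add: A_const B_const cong: sum.cong)
  have ipA: "dX * (\<Sum>x\<in>X. u x * B (A v) x) = dY * (\<Sum>y\<in>Y. A u y * A v y)" for u v
    by (rule adj)
  have sa: "(\<Sum>x\<in>X. u x * B (A v) x) = (\<Sum>x\<in>X. B (A u) x * v x)" for u v
  proof -
    have "dX * (\<Sum>x\<in>X. u x * B (A v) x) = dX * (\<Sum>x\<in>X. v x * B (A u) x)"
      unfolding ipA by (simp add: mult.commute)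
    then show ?thesis using dpos by (simp add: mult.commute)
  qed
  have A_lip: "\<bar>A u y - A u (q i y)\<bar> \<le> \<kappa> * L"
    if "\<And>x. x \<in> X \<Longrightarrow> \<bar>u x - u (p i x)\<bar> \<le> L" "L \<ge> 0" "i \<in> I" "y \<in> Y" for u L i y
    unfolding A_def
  proof (rule averaging_contracts[where X = X and P = "p i"])
    have "{x \<in> X. D x y} - {x \<in> X. D x (q i y)} = {x\<in>X. D x y \<and> \<not> D x (q i y)}" by auto
    then show "real (card ({x \<in> X. D x y} - {x \<in> X. D x (q i y)})) \<le> \<kappa> * real dY"
      using kY[of i y] that by simp
  qed (use that fin p q D dpos in auto)
  have B_lip: "\<bar>B w x - B w (p i x)\<bar> \<le> \<kappa> * L"
    if "\<And>y. y \<in> Y \<Longrightarrow> \<bar>w y - w (q i y)\<bar> \<le> L" "L \<ge> 0" "i \<in> I" "x \<in> X" for w L i x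
    unfolding B_def
  proof (rule averaging_contracts[where X = Y and P = "q i"])
    have "{y \<in> Y. D x y} - {y \<in> Y. D (p i x) y} = {y\<in>Y. D x y \<and> \<not> D (p i x) y}" by auto
    then show "real (card ({y \<in> Y. D x y} - {y \<in> Y. D (p i x) y})) \<le> \<kappa> * real dX"
      using kX[of i x] that by simp
  qed (use that fin p q D dpos in auto)
  \<comment> \<open>Subtracting the density of \<open>f\<close> makes its indicator orthogonal to
    the constants.\<close>
  define \<alpha> where "\<alpha> = real (card f) / card X"
  define u0 :: "'a \<Rightarrow> real" where "u0 x = indicat_real f x - \<alpha>" for x
  define u where "u s = ((\<lambda>v. B (A v)) ^^ s) u0" for s
  have u_Suc: "u (Suc s) = B (A (u s))" for s by (simp add: u_def)
  have cX: "real (card X) > 0" using fin ne by (simp add: card_gt_0_iff)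
  have sum_ind: "(\<Sum>x\<in>X. indicat_real f x) = card f"
    using fin f by (simp add: indicator_def sum.If_cases Int_absorb1)
  have mean0: "(\<Sum>x\<in>X. u s x) = 0" for s
  proof (induction s)
    case 0
    have "(\<Sum>x\<in>X. u0 x) = 0" using cX by (simp add: u0_def sum_subtractf sum_ind \<alpha>_def)
    then show ?case by (simp add: u_def)
  next
    case (Suc s)
    have "(\<Sum>x\<in>X. u (Suc s) x) = (\<Sum>x\<in>X. B (A (\<lambda>_. 1)) x * u s x)"
      using sa[of "\<lambda>_. 1" "u s"] by (simp add: u_Suc)
    also have "\<dots> = (\<Sum>x\<in>X. u s x)"
    proof (intro sum.cong refl)
      fix x assume "x \<in> X"
      have "B (A (\<lambda>_. 1)) x = B (\<lambda>_. 1) x" unfolding B_def by (simp add: A_const)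
      then show "B (A (\<lambda>_. 1)) x * u s x = u s x" using B_const[OF \<open>x \<in> X\<close>, of 1] by simp
    qed
    finally show ?case using Suc by simp
  qed
  have lip: "\<bar>u s x - u s (p i x)\<bar> \<le> (\<kappa>\<^sup>2) ^ s" if "x \<in> X" "i \<in> I" for s x i
    using that
  proof (induction s arbitrary: x i)
    case 0
    then show ?case by (auto simp: u_def u0_def indicator_def)
  next
    case (Suc s)
    have "\<bar>A (u s) y - A (u s) (q i y)\<bar> \<le> \<kappa> * (\<kappa>\<^sup>2) ^ s" if "y \<in> Y" for y
      using that Suc by (intro A_lip) auto
    then have "\<bar>u (Suc s) x - u (Suc s) (p i x)\<bar> \<le> \<kappa> * (\<kappa> * (\<kappa>\<^sup>2) ^ s)"
      unfolding u_Suc using Suc \<kappa> by (intro B_lip) auto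
    then show ?case by (simp add: power2_eq_square mult.assoc)
  qed
  obtain m :: nat where m: "\<And>w :: 'a \<Rightarrow> real. \<And>L x x'. (\<And>x i. x \<in> X \<Longrightarrow> i \<in> I \<Longrightarrow> \<bar>w x - w (p i x)\<bar> \<le> L)
      \<Longrightarrow> x \<in> X \<Longrightarrow> x' \<in> X \<Longrightarrow> L \<ge> 0 \<Longrightarrow> \<bar>w x - w x'\<bar> \<le> real m * L"
    by (rule Lipschitz_bound_along_moves[OF fin(1) conn]) blast+
  \<comment> \<open>A function of mean zero is bounded by its oscillation: \<open>u s x\<close> is
    the average over \<open>x'\<close> of \<open>u s x - u s x'\<close>.\<close>
  have sup: "\<bar>u s x\<bar> \<le> m * (\<kappa>\<^sup>2) ^ s" if x: "x \<in> X" for s x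
  proof -
    have "card X * u s x = (\<Sum>x'\<in>X. u s x - u s x')" using mean0[of s] by (simp add: sum_subtractf)
    then have "card X * \<bar>u s x\<bar> = \<bar>\<Sum>x'\<in>X. u s x - u s x'\<bar>" by (metis abs_mult abs_of_nat)
    also have "\<dots> \<le> (\<Sum>x'\<in>X. m * (\<kappa>\<^sup>2) ^ s)"
    proof (rule order.trans[OF sum_abs], rule sum_mono)
      fix x' assume "x' \<in> X"
      then show "\<bar>u s x - u s x'\<bar> \<le> m * (\<kappa>\<^sup>2) ^ s" by (intro m[of "u s"] lip x) auto
    qed
    finally have "card X * \<bar>u s x\<bar> \<le> card X * (m * (\<kappa>\<^sup>2) ^ s)" by simp
    then show ?thesis using cX by (simp only: mult_le_cancel_left_pos)
  qed
  define b where "b s = (\<Sum>x\<in>X. (u s x)\<^sup>2)" for s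
  \<comment> \<open>The prefactor \<open>card X * m\<^sup>2\<close> may be huge; log-convexity
    discards it and keeps only the rate.\<close>
  have "b 1 \<le> (\<kappa>\<^sup>2)\<^sup>2 * b 0"
  proof (rule log_convex_geometric)
    fix s
    show "b s \<ge> 0" by (simp add: b_def sum_nonneg)
    have "b (Suc s) = (\<Sum>x\<in>X. u s x * u (Suc (Suc s)) x)"
      unfolding b_def power2_eq_square u_Suc[of "Suc s"] sa by (simp add: u_Suc)
    then show "(b (Suc s))\<^sup>2 \<le> b s * b (Suc (Suc s))"
      unfolding b_def using Cauchy_Schwarz_ineq_sum[of "u s" "u (Suc (Suc s))" X] by simp
    have "b s \<le> (\<Sum>x\<in>X. (m * (\<kappa>\<^sup>2) ^ s)\<^sup>2)"
      unfolding b_def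
    proof (intro sum_mono)
      fix x assume "x \<in> X"
      from sup[OF this, of s] have "\<bar>u s x\<bar>\<^sup>2 \<le> (m * (\<kappa>\<^sup>2) ^ s)\<^sup>2" by (intro power_mono) auto
      then show "(u s x)\<^sup>2 \<le> (m * (\<kappa>\<^sup>2) ^ s)\<^sup>2" by simp
    qed
    also have "\<dots> = (card X * m\<^sup>2) * ((\<kappa>\<^sup>2)\<^sup>2) ^ s"
      by (simp add: power_mult_distrib power_mult[symmetric] mult.commute mult.left_commute)
    finally show "b s \<le> (card X * m\<^sup>2) * ((\<kappa>\<^sup>2)\<^sup>2) ^ s" .
  qed (use \<kappa> in auto)
  define z where "z = (\<Sum>y\<in>Y. (A u0 y)\<^sup>2)"
  \<comment> \<open>By adjointness \<open>z\<close> is, up to the degrees, the inner product of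
    \<open>u0\<close> and \<open>B (A u0)\<close>. Cauchy-Schwarz and the bound on
    \<open>b 1\<close> yield the factor \<open>\<kappa>\<^sup>2\<close>.\<close>
  have z: "dY * z \<le> dX * (\<kappa>\<^sup>2 * b 0)"
  proof -
    have "(\<Sum>x\<in>X. u0 x * B (A u0) x)\<^sup>2 \<le> b 0 * b 1"
      using Cauchy_Schwarz_ineq_sum[of u0 "B (A u0)" X] by (simp add: b_def u_def)
    also have "\<dots> \<le> b 0 * ((\<kappa>\<^sup>2)\<^sup>2 * b 0)"
      using \<open>b 1 \<le> (\<kappa>\<^sup>2)\<^sup>2 * b 0\<close> by (intro mult_left_mono) (auto simp: b_def sum_nonneg)
    also have "\<dots> = (\<kappa>\<^sup>2 * b 0)\<^sup>2" by (simp add: power2_eq_square)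
    finally have "(\<Sum>x\<in>X. u0 x * B (A u0) x) \<le> \<kappa>\<^sup>2 * b 0"
      by (rule power2_le_imp_le) (auto simp: b_def intro!: mult_nonneg_nonneg sum_nonneg)
    from mult_left_mono[OF this, of "real dX"] show ?thesis
      using ipA[of u0 u0] by (simp add: z_def power2_eq_square)
  qed
  have b0: "b 0 \<le> card f"
  proof -
    have "b 0 = (\<Sum>x\<in>X. indicat_real f x - 2 * \<alpha> * indicat_real f x + \<alpha>\<^sup>2)"
      unfolding b_def u_def u0_def
      by (intro sum.cong refl) (auto simp: indicator_def power2_eq_square algebra_simps)
    also have "\<dots> = card f - 2 * \<alpha> * card f + card X * \<alpha>\<^sup>2"
      by (simp add: sum.distrib sum_subtractf sum_ind flip: sum_distrib_left)
    also have "card X * \<alpha>\<^sup>2 = \<alpha> * card f" using cX by (simp add: \<alpha>_def power2_eq_square)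
    finally have "b 0 = card f - \<alpha> * card f" by simp
    moreover have "\<alpha> * card f \<ge> 0" by (simp add: \<alpha>_def)
    ultimately show ?thesis by linarith
  qed
  \<comment> \<open>A point of \<open>g\<close> has no neighbour in \<open>f\<close>, so it averages
    the constant value of \<open>u0\<close> off \<open>f\<close>. Hence every point of
    \<open>g\<close> contributes \<open>\<alpha>\<^sup>2\<close> to \<open>z\<close>.\<close>
  have A_g: "A u0 y = - \<alpha>" if "y \<in> g" for y
  proof -
    have y: "y \<in> Y" using that g by auto
    have "(\<Sum>x | x \<in> X \<and> D x y. u0 x) = (\<Sum>x | x \<in> X \<and> D x y. - \<alpha>)"
      by (intro sum.cong refl) (use indep[OF _ that] in \<open>auto simp: u0_def indicator_def\<close>)
    then show ?thesis using A_const[OF y, of "-\<alpha>"] by (simp add: A_def)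
  qed
  have "card g * \<alpha>\<^sup>2 = (\<Sum>y\<in>g. (A u0 y)\<^sup>2)" by (simp add: A_g)
  also have "\<dots> \<le> z" unfolding z_def using g fin by (intro sum_mono2) auto
  finally have "dY * (card g * \<alpha>\<^sup>2) \<le> dY * z" by (simp add: mult_left_mono)
  also have "\<dots> \<le> dX * (\<kappa>\<^sup>2 * card f)"
    using z b0 by (elim order.trans) (intro mult_left_mono; simp)
  finally have "real dY * (card g * \<alpha>\<^sup>2) * card X \<le> real dX * (\<kappa>\<^sup>2 * card f) * card X"
    by (intro mult_right_mono) auto
  also have "\<dots> = real dY * (\<kappa>\<^sup>2 * card f * card Y)" using count by (simp add: algebra_simps)
  finally have "card g * \<alpha>\<^sup>2 * card X \<le> \<kappa>\<^sup>2 * card f * card Y"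
    using dpos by (simp add: mult.assoc)
  moreover have "card g * \<alpha>\<^sup>2 * card X = card f * (card f * card g / card X)"
    using cX by (simp add: \<alpha>_def power2_eq_square)
  ultimately have *: "card f * (card f * card g / card X) \<le> card f * (\<kappa>\<^sup>2 * card Y)"
    by (simp add: mult_ac)
  show ?thesis
  proof (cases "card f = 0")
    case False
    then have "real (card f) * card g / card X \<le> \<kappa>\<^sup>2 * card Y"
      using mult_left_le_imp_le[OF *] by simp
    then show ?thesis using cX by (simp add: pos_divide_le_eq mult_ac)
  qed simp
qed

section \<open>Perfect hypermatchings and skewness\<close>

lemma sum_card_swap:
  assumes "finite A" "finite B"
  shows "(\<Sum>a\<in>A. card {b\<in>B. R a b}) = (\<Sum>b\<in>B. card {a\<in>A. R a b})"
  using sum.swap_restrict[OF assms, of "\<lambda>_ _. 1::nat" R] by simp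

text \<open>Reciprocal of the fraction that switching guarantees: the factor 2 comes from Markov's
  inequality, which leaves at most \<open>4 * k\<^sup>2\<close> obstructing pairs, and lowering
  their number by one costs a factor \<open>1 + 2 * k\<^sup>2\<close>.\<close>

definition skew_const :: "nat \<Rightarrow> nat" where
  "skew_const k = 2 * (1 + 2 * k\<^sup>2) ^ (4 * k\<^sup>2)"

lemma bij_betw_fixing:
  assumes "finite e" "finite e'" "card e = card e'" "S \<subseteq> e \<inter> e'"
  obtains g where "bij_betw g e e'" "\<And>s. s \<in> S \<Longrightarrow> g s = s"
proof -
  have fS: "finite S" using assms by (meson finite_Int finite_subset)
  have "card (e - S) = card (e' - S)"
    using assms fS by (simp add: card_Diff_subset)
  then obtain h where h: "bij_betw h (e - S) (e' - S)"
    using assms finite_same_card_bij[of "e - S" "e' - S"] by auto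
  define g where "g v = (if v \<in> S then v else h v)" for v
  have "bij_betw g (e - S) (e' - S)" using h by (rule bij_betw_cong[THEN iffD1, rotated]) (simp add: g_def)
  moreover have "bij_betw g S S" by (simp add: bij_betw_def inj_on_def g_def)
  ultimately have "bij_betw g ((e - S) \<union> S) ((e' - S) \<union> S)" by (rule bij_betw_combine) auto
  moreover have "(e - S) \<union> S = e" "(e' - S) \<union> S = e'" using assms by auto
  ultimately show ?thesis using that[of g] by (simp add: g_def)
qed

lemma disjoint_pair_rest:
  assumes "disjoint m" "c \<in> m" "d \<in> m"
  shows "(c \<union> d) \<inter> \<Union>(m - {c, d}) = {}" "(c \<union> d) \<union> \<Union>(m - {c, d}) = \<Union>m"
proof -
  have "c \<inter> e = {} \<and> d \<inter> e = {}" if "e \<in> m - {c, d}" for e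
    using assms that unfolding disjoint_def by blast
  then show "(c \<union> d) \<inter> \<Union>(m - {c, d}) = {}" by blast
  show "(c \<union> d) \<union> \<Union>(m - {c, d}) = \<Union>m" using assms(2,3) by blast
qed

section \<open>Mates, skewness and relabelling of points\<close>

definition mate :: "nat set set \<Rightarrow> nat \<Rightarrow> nat \<Rightarrow> bool" where
  "mate m u v \<longleftrightarrow> (\<exists>e\<in>m. u \<in> e \<and> v \<in> e)"

definition skew :: "nat set set \<Rightarrow> nat set set \<Rightarrow> bool" where
  "skew m m' \<longleftrightarrow> (\<forall>u v. mate m u v \<and> mate m' u v \<longrightarrow> u = v)"

abbreviation relabel :: "(nat \<Rightarrow> nat) \<Rightarrow> nat set set \<Rightarrow> nat set set" where
  "relabel \<sigma> m \<equiv> (`) \<sigma> ` m"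

lemma mate_sym: "mate m u v \<longleftrightarrow> mate m v u"
  by (auto simp: mate_def)

lemma skew_sym: "skew m m' \<longleftrightarrow> skew m' m"
  by (auto simp: skew_def)

lemma mate_relabel: "bij \<sigma> \<Longrightarrow> mate (relabel \<sigma> m) (\<sigma> u) (\<sigma> v) \<longleftrightarrow> mate m u v"
  by (auto simp: mate_def bij_def inj_image_mem_iff)

lemma mate_transpose:
  "mate (relabel (transpose a b) m) u v \<longleftrightarrow> mate m (transpose a b u) (transpose a b v)"
  using mate_relabel[of "transpose a b" m "transpose a b u" "transpose a b v"] by simp

lemma skew_relabel:
  assumes "bij \<sigma>" shows "skew (relabel \<sigma> x) (relabel \<sigma> y) \<longleftrightarrow> skew x y"
proof -
  have "skew (relabel \<sigma> x) (relabel \<sigma> y) \<longleftrightarrow>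
    (\<forall>u v. mate (relabel \<sigma> x) (\<sigma> u) (\<sigma> v) \<and> mate (relabel \<sigma> y) (\<sigma> u) (\<sigma> v) \<longrightarrow> \<sigma> u = \<sigma> v)"
    unfolding skew_def using assms by (metis bij_pointE)
  also have "\<dots> \<longleftrightarrow> skew x y"
    using assms by (auto simp: mate_relabel skew_def bij_def inj_eq)
  finally show ?thesis .
qed

lemma relabel_comp: "relabel \<sigma> (relabel \<tau> m) = relabel (\<sigma> \<circ> \<tau>) m"
  by (simp add: image_image image_comp)

lemma relabel_transpose_twice [simp]: "relabel (transpose a b) (relabel (transpose a b) m) = m"
  by (simp add: image_image)

lemma skew_relabel_transpose:
  "skew (relabel (transpose a b) x) y \<longleftrightarrow> skew x (relabel (transpose a b) y)"
  using skew_relabel[of "transpose a b" x "relabel (transpose a b) y"] by simp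

text \<open>The bound on \<open>n\<close> ensures that the at most \<open>2 + 2 * k\<^sup>2\<close>
  points forbidden in a switch are no more than half of all points, and that
  \<open>k * n - 3\<close> is at least half of \<open>k * n\<close>.\<close>

locale hypermatchings =
  fixes k n :: nat
  assumes k2: "k \<ge> 2" and n_large: "n \<ge> 4 * k + 4"
begin

abbreviation V :: "nat set" where "V \<equiv> {1..k * n}"

abbreviation M :: "nat set set set" where "M \<equiv> perfect_hypermatchings k n"

lemma kn_large: "k * n \<ge> 4 * k * k + 4 * k"
  using mult_le_mono2[OF n_large, of k] by (simp add: algebra_simps)

lemma M_iff: "m \<in> M \<longleftrightarrow> partition_on V m \<and> card m = n \<and> (\<forall>e\<in>m. card e = k)"
  by (simp add: perfect_hypermatchings_def)

lemma finite_M [simp, intro]: "finite M"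
proof (rule finite_subset)
  show "M \<subseteq> Pow (Pow V)" unfolding M_iff[abs_def] partition_on_def subset_iff Pow_iff by blast
qed simp

lemma mateD: "m \<in> M \<Longrightarrow> mate m u v \<Longrightarrow> u \<in> V \<and> v \<in> V"
  unfolding M_iff partition_on_def mate_def by blast

lemma mate_refl: "m \<in> M \<Longrightarrow> u \<in> V \<Longrightarrow> mate m u u"
  unfolding M_iff partition_on_def mate_def by blast

lemma mates_eq_block:
  assumes "m \<in> M" "e \<in> m" "u \<in> e" shows "{v. mate m u v} = e"
  using assms unfolding M_iff partition_on_def mate_def disjoint_def by blast

lemma card_mates: assumes "m \<in> M" "u \<in> V" shows "card {v. mate m u v} = k"
proof -
  obtain e where "e \<in> m" "u \<in> e" using mate_refl[OF assms] by (auto simp: mate_def)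
  then show ?thesis using mates_eq_block[OF assms(1)] assms(1) by (auto simp: M_iff)
qed

lemma finite_mates: "m \<in> M \<Longrightarrow> finite {v. mate m u v}"
  by (rule finite_subset[of _ V]) (auto dest: mateD)

lemma card_mates_le: assumes "m \<in> M" shows "card {v. mate m u v} \<le> k"
proof (cases "u \<in> V")
  case False
  then have "{v. mate m u v} = {}" using mateD[OF assms] by blast
  then show ?thesis by simp
qed (simp add: card_mates assms)

lemma relabel_in_M:
  assumes "\<sigma> permutes V" "m \<in> M" shows "relabel \<sigma> m \<in> M"
proof -
  have b: "bij \<sigma>" using assms(1) by (rule permutes_bij)
  have inj: "inj \<sigma>" using b by (rule bij_is_inj)
  have "partition_on (\<sigma> ` V) (relabel \<sigma> m)"
    unfolding partition_on_def
  proof (intro conjI)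
    have "\<Union> (relabel \<sigma> m) = \<sigma> ` \<Union> m" by blast
    then show "\<Union> (relabel \<sigma> m) = \<sigma> ` V" using assms(2) by (simp add: M_iff partition_on_def)
    show "disjoint (relabel \<sigma> m)"
      unfolding disjoint_def
    proof (intro ballI impI)
      fix A B assume "A \<in> relabel \<sigma> m" "B \<in> relabel \<sigma> m" "A \<noteq> B"
      then obtain e e' where "e \<in> m" "e' \<in> m" "e \<noteq> e'" "A = \<sigma> ` e" "B = \<sigma> ` e'" by blast
      moreover from this have "e \<inter> e' = {}"
        using assms(2) by (auto simp: M_iff partition_on_def disjoint_def)
      ultimately show "A \<inter> B = {}" by (simp add: image_Int[OF inj, symmetric])
    qed
    show "{} \<notin> relabel \<sigma> m" using assms(2) by (auto simp: M_iff partition_on_def)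
  qed
  moreover have "card (relabel \<sigma> m) = card m"
    by (intro card_image inj_onI) (use inj in \<open>simp add: inj_image_eq_iff\<close>)
  moreover have "\<forall>e\<in>relabel \<sigma> m. card e = k"
    using assms(2) by (auto simp: M_iff card_image inj_on_subset[OF inj])
  ultimately show ?thesis
    using assms permutes_image[OF assms(1)] by (auto simp: M_iff)
qed

lemma relabel_transpose_in_M:
  "a \<in> V \<Longrightarrow> b \<in> V \<Longrightarrow> m \<in> M \<Longrightarrow> relabel (transpose a b) m \<in> M"
  by (rule relabel_in_M) (auto intro: permutes_swap_id)

lemma partially_2_intersect_iff:
  assumes "m \<in> M" "m' \<in> M" shows "partially_2_intersect m m' \<longleftrightarrow> \<not> skew m m'"
proof
  assume "partially_2_intersect m m'"
  then obtain e e' where e: "e \<in> m" "e' \<in> m'" "card (e \<inter> e') \<ge> 2"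
    by (auto simp: partially_2_intersect_def)
  then have "\<not> is_singleton (e \<inter> e')" "e \<inter> e' \<noteq> {}"
    by (auto simp: is_singleton_altdef)
  then obtain u v where "u \<in> e \<inter> e'" "v \<in> e \<inter> e'" "u \<noteq> v"
    by (metis is_singletonI' )
  then show "\<not> skew m m'" using e unfolding skew_def mate_def by blast
next
  assume "\<not> skew m m'"
  then obtain u v e e' where e: "e \<in> m" "e' \<in> m'" "{u, v} \<subseteq> e \<inter> e'" "u \<noteq> v"
    unfolding skew_def mate_def by blast
  have "finite e" using e(1) assms k2 by (metis M_iff card.infinite not_numeral_le_zero)
  then have "card {u, v} \<le> card (e \<inter> e')" using e by (intro card_mono) auto
  then have "card (e \<inter> e') \<ge> 2" using e(4) by simp
  then show "partially_2_intersect m m'" using e unfolding partially_2_intersect_def by blast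
qed

section \<open>Hypermatchings skew to a given one\<close>

text \<open>Invariance under the symmetric group fixing \<open>a\<close> and \<open>b\<close>,
  expressed by transpositions. It covers all hypermatchings as well as those with \<open>a\<close>,
  \<open>b\<close> together or apart, so each counting argument is carried out once.\<close>

definition stable :: "nat \<Rightarrow> nat \<Rightarrow> nat set set set \<Rightarrow> bool" where
  "stable a b X \<longleftrightarrow> X \<subseteq> M \<and>
     (\<forall>u\<in>V - {a, b}. \<forall>v\<in>V - {a, b}. \<forall>x\<in>X. relabel (transpose u v) x \<in> X)"

lemma stable_finite: "stable a b X \<Longrightarrow> finite X"
  unfolding stable_def by (meson finite_M finite_subset)

lemma stable_M: "stable a b M"
  by (auto simp: stable_def intro: relabel_transpose_in_M)

lemma mate_transpose_fixed:
  assumes "a \<notin> {u, v}" "b \<notin> {u, v}"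
  shows "mate (relabel (transpose u v) x) a b \<longleftrightarrow> mate x a b"
  using assms by (simp add: mate_transpose)

lemma stable_together: "stable a b {y\<in>M. mate y a b}"
  by (auto simp: stable_def mate_transpose_fixed intro: relabel_transpose_in_M)

lemma stable_apart: "stable a b {y\<in>M. \<not> mate y a b}"
  by (auto simp: stable_def mate_transpose_fixed intro: relabel_transpose_in_M)

section \<open>Frequency of a pair of mates in a stable family\<close>

lemma pair_count_eq:
  assumes "stable a b X" "u \<in> V - {a, b}" "u' \<in> V - {a, b}" "v \<noteq> u" "v \<noteq> u'"
  shows "card {y\<in>X. mate y u v} = card {y\<in>X. mate y u' v}"
proof (rule bij_betw_same_card)
  have "relabel (transpose u u') y \<in> X" if "y \<in> X" for y
    using assms that by (auto simp: stable_def)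
  \<comment> \<open>The transposition preserves \<open>X\<close> and leaves \<open>v\<close> in
    place, even if \<open>v\<close> is \<open>a\<close> or \<open>b\<close>.\<close>
  then show "bij_betw (relabel (transpose u u')) {y\<in>X. mate y u v} {y\<in>X. mate y u' v}"
    using assms by (intro bij_betw_byWitness[where f' = "relabel (transpose u u')"])
      (auto simp: mate_transpose)
qed

text \<open>By symmetry the count is the same for all partners of \<open>v\<close> outside
  \<open>{a, b, v}\<close>, and each member of \<open>X\<close> supplies at most \<open>k\<close> of
  them.\<close>

lemma pair_count_bound:
  assumes X: "stable a b X" and u: "u \<in> V - {a, b}" and v: "v \<noteq> u"
  shows "(k * n - 3) * card {y\<in>X. mate y u v} \<le> k * card X"
proof -
  let ?U = "V - {a, b, v}"
  have finX: "finite X" using X by (rule stable_finite)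
  have "card V - card {a, b, v} \<le> card ?U" by (rule diff_card_le_card_Diff) simp
  moreover have "card {a, b, v} \<le> 3" by (simp add: card_insert_if)
  ultimately have "k * n - 3 \<le> card ?U" by simp
  then have "(k * n - 3) * card {y\<in>X. mate y u v} \<le> (\<Sum>u'\<in>?U. card {y\<in>X. mate y u v})"
    by simp
  also have "\<dots> = (\<Sum>u'\<in>?U. card {y\<in>X. mate y u' v})"
    by (intro sum.cong refl pair_count_eq[OF X]) (use u v in auto)
  also have "\<dots> = (\<Sum>y\<in>X. card {u'\<in>?U. mate y u' v})"
    by (rule sum_card_swap) (use finX in auto)
  also have "\<dots> \<le> (\<Sum>y\<in>X. k)"
  proof (rule sum_mono)
    fix y assume "y \<in> X"
    then have y: "y \<in> M" using X by (auto simp: stable_def)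
    have "card {u'\<in>?U. mate y u' v} \<le> card {u'. mate y v u'}"
      by (intro card_mono[OF finite_mates[OF y]]) (auto simp: mate_sym)
    then show "card {u'\<in>?U. mate y u' v} \<le> k" using card_mates_le[OF y, of v] by linarith
  qed
  finally show ?thesis by (simp add: mult.commute)
qed

text \<open>Each point has \<open>k - 1\<close> mates besides itself, so a canonical family has
  density exactly \<open>(k - 1) / (k * n - 1)\<close>. This is where the lower bound of order
  \<open>1 / n\<close> for the density of a largest family comes from.\<close>

lemma card_M_le:
  assumes ab: "a \<in> V" "b \<in> V" "a \<noteq> b"
  shows "card M \<le> 2 * n * card {y\<in>M. mate y a b}"
proof -
  have "(k * n - 1) * card {y\<in>M. mate y a b} = (\<Sum>v\<in>V - {b}. card {y\<in>M. mate y a b})"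
    using ab by simp
  \<comment> \<open>With both exceptional points equal to \<open>b\<close>, every other point may be
    exchanged, \<open>a\<close> included.\<close>
  also have "\<dots> = (\<Sum>v\<in>V - {b}. card {y\<in>M. mate y v b})"
    by (intro sum.cong refl pair_count_eq[of b b]) (use ab stable_M in auto)
  also have "\<dots> = (\<Sum>y\<in>M. card {v\<in>V - {b}. mate y v b})"
    by (rule sum_card_swap) auto
  also have "\<dots> = (\<Sum>y\<in>M. k - 1)"
  proof (rule sum.cong[OF refl])
    fix y assume y: "y \<in> M"
    have "{v\<in>V - {b}. mate y v b} = {v. mate y b v} - {b}"
      using mateD[OF y] by (auto simp: mate_sym)
    then show "card {v\<in>V - {b}. mate y v b} = k - 1"
      using card_mates[OF y ab(2)] mate_refl[OF y ab(2)] finite_mates[OF y]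
      by (simp add: card_Diff_singleton)
  qed
  finally have eq: "(k * n - 1) * card {y\<in>M. mate y a b} = card M * (k - 1)"
    by (simp only: sum_constant of_nat_id)
  have "k * card M \<le> 2 * ((k - 1) * card M)" 
  proof -
    have "k \<le> 2 * (k - 1)" using k2 by linarith
    from mult_le_mono1[OF this, of "card M"] show ?thesis by (simp only: mult.assoc)
  qed
  also have "\<dots> = 2 * ((k * n - 1) * card {y\<in>M. mate y a b})" by (simp only: eq mult.commute[of "k - 1"])
  also have "\<dots> \<le> 2 * (k * n * card {y\<in>M. mate y a b})" by (intro mult_le_mono) auto
  also have "\<dots> = k * (2 * n * card {y\<in>M. mate y a b})" by simp
  finally show ?thesis using k2 by simp
qed

lemma card_mate_mate:
  assumes "x \<in> M" "y \<in> M"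
  shows "card {v. \<exists>w. mate x u w \<and> mate y w v} \<le> k * k" "finite {v. \<exists>w. mate x u w \<and> mate y w v}"
proof -
  have eq: "{v. \<exists>w. mate x u w \<and> mate y w v} = (\<Union>w\<in>{w. mate x u w}. {v. mate y w v})" by auto
  have "card (\<Union>w\<in>{w. mate x u w}. {v. mate y w v}) \<le> (\<Sum>w | mate x u w. card {v. mate y w v})"
    using finite_mates[OF assms(1)] by (rule card_UN_le)
  also have "\<dots> \<le> (\<Sum>w | mate x u w. k)" by (intro sum_mono card_mates_le assms)
  also have "\<dots> \<le> k * k" using card_mates_le[OF assms(1)] by simp
  finally show "card {v. \<exists>w. mate x u w \<and> mate y w v} \<le> k * k" unfolding eq .
  show "finite {v. \<exists>w. mate x u w \<and> mate y w v}"
    unfolding eq using finite_mates assms by auto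
qed

text \<open>An obstruction created by the transposition involves \<open>u\<close> or
  \<open>v\<close>, paired with one of at most \<open>k\<close> mates in the new hypermatching. The
  members lost thus lie in at most \<open>2 * k\<close> canonical families.\<close>

lemma skew_change_bound:
  fixes B :: real
  assumes x: "x \<in> M" and F: "F \<subseteq> M" and uv: "u \<in> V" "v \<in> V"
    and B: "\<And>q. q \<noteq> u \<Longrightarrow> real (card {y\<in>F. mate y u q}) \<le> B"
           "\<And>q. q \<noteq> v \<Longrightarrow> real (card {y\<in>F. mate y v q}) \<le> B"
  shows "real (card {y\<in>F. skew x y \<and> \<not> skew (relabel (transpose u v) x) y}) \<le> 2 * k * B"
proof -
  let ?x = "relabel (transpose u v) x"
  have x': "?x \<in> M" using uv x by (rule relabel_transpose_in_M)
  have finF: "finite F" using F finite_M by (rule finite_subset)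
  have B0: "B \<ge> 0" using order.trans[OF _ B(1)[of "Suc u"]] by simp
  let ?S = "\<lambda>p. \<Union>q\<in>{q. mate ?x p q} - {p}. {y\<in>F. mate y p q}"
  have S: "real (card (?S p)) \<le> k * B" if "p \<in> {u, v}" for p
  proof -
    have "real (card (?S p)) \<le> (\<Sum>q\<in>{q. mate ?x p q} - {p}. real (card {y\<in>F. mate y p q}))"
      using card_UN_le[of "{q. mate ?x p q} - {p}" "\<lambda>q. {y\<in>F. mate y p q}"] finite_mates[OF x']
      by (simp flip: of_nat_sum)
    also have "\<dots> \<le> (\<Sum>q\<in>{q. mate ?x p q} - {p}. B)" by (intro sum_mono) (use that B in auto)
    also have "\<dots> = card ({q. mate ?x p q} - {p}) * B" by simp
    also have "\<dots> \<le> k * B"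
      using card_mono[OF finite_mates[OF x'], of "{q. mate ?x p q} - {p}" p] card_mates_le[OF x', of p] B0
      by (intro mult_right_mono) auto
    finally show ?thesis .
  qed
  have "{y\<in>F. skew x y \<and> \<not> skew ?x y} \<subseteq> ?S u \<union> ?S v"
  proof safe
    fix y assume y: "y \<in> F" "skew x y" "\<not> skew ?x y" "y \<notin> ?S v"
    then obtain p q where pq: "mate ?x p q" "mate y p q" "p \<noteq> q" by (auto simp: skew_def)
    have "\<not> mate x p q" using y pq by (auto simp: skew_def)
    then have "p \<in> {u, v} \<or> q \<in> {u, v}" using pq(1) by (metis mate_transpose_fixed)
    then show "y \<in> ?S u" using pq y by (auto simp: mate_sym)
  qed
  then have "card {y\<in>F. skew x y \<and> \<not> skew ?x y} \<le> card (?S u \<union> ?S v)"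
    using finF finite_mates[OF x'] by (intro card_mono) auto
  also have "\<dots> \<le> card (?S u) + card (?S v)" by (rule card_Un_le)
  finally show ?thesis using S[of u] S[of v] by simp
qed

text \<open>\<open>Z y\<close> collects the pairs that prevent \<open>y\<close> from being skew to \<open>x\<close>. Transposing a point \<open>u\<close>
  of such a pair with \<open>v\<close> lowers their number for at least \<open>k n / 2\<close> choices of \<open>v\<close>. Conversely,
  in the new hypermatching some mate of \<open>v\<close> is a mate of \<open>u\<close> in \<open>x\<close>, which leaves only
  \<open>k n * k\<^sup>2\<close> possibilities for \<open>(u, v)\<close>.\<close>

lemma switching_step:
  assumes x: "x \<in> M" and X: "stable a b X" and ab: "a \<noteq> b"
    and W: "W = {(u, w). u \<in> V - {a, b} \<and> w \<noteq> u \<and> mate x u w}"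
    and Z: "\<And>y. Z y = {p\<in>W. mate y (fst p) (snd p)}"
  shows "card {y\<in>X. card (Z y) \<le> Suc t} \<le> (1 + 2 * k\<^sup>2) * card {y\<in>X. card (Z y) \<le> t}"
proof -
  define A where "A s = {y\<in>X. card (Z y) \<le> s}" for s
  define E where "E = A (Suc t) - A t"
  have finX: "finite X" using X by (rule stable_finite)
  have XM: "y \<in> M" if "y \<in> X" for y using X that by (auto simp: stable_def)
  have finW: "finite W" by (rule finite_subset[of _ "V \<times> V"]) (use mateD[OF x] W in auto)
  have finZ: "finite (Z y)" for y using finW by (simp add: Z)
  \<comment> \<open>An arbitrary obstructing pair is selected; its first point is the one to be
    moved.\<close>
  define r where "r y = fst (SOME p. p \<in> Z y)" for y
  have r: "\<exists>w. (r y, w) \<in> Z y" if "y \<in> E" for y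
  proof -
    have "Z y \<noteq> {}" using that by (auto simp: E_def A_def)
    then show ?thesis unfolding r_def by (metis ex_in_conv prod.collapse someI_ex)
  qed
  \<comment> \<open>The two conditions keep the transposition of \<open>r y\<close> and
    \<open>v\<close> from creating obstructions at either moved point. Each of them excludes at most
    \<open>k * k\<close> points.\<close>
  define good where "good y = {v\<in>V - {a, b}. (\<nexists>w. mate y (r y) w \<and> mate x w v) \<and>
     (\<nexists>w. mate x (r y) w \<and> mate y w v)}" for y
  define R where "R y = {(u, v). u \<in> V \<and> (\<exists>w. mate x u w \<and> mate y w v)}" for y
  \<comment> \<open>Recording \<open>r y\<close> and \<open>v\<close> beside the new hypermatching
    makes the map injective, since the same transposition undoes it.\<close>
  define \<Phi> where "\<Phi> = (\<lambda>(y, v). (relabel (transpose (r y) v) y, (r y, v)))"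
  have good_card: "k * n \<le> 2 * card (good y)" if "y \<in> E" for y
  proof -
    have y: "y \<in> M" using that XM by (auto simp: E_def A_def)
    let ?S = "{a, b} \<union> {v. \<exists>w. mate y (r y) w \<and> mate x w v} \<union> {v. \<exists>w. mate x (r y) w \<and> mate y w v}"
    have "card ?S \<le> card {a, b} + k * k + k * k"
      by (intro order.trans[OF card_Un_le] add_mono card_mate_mate x y order.refl)
    moreover have "card V - card ?S \<le> card (V - ?S)"
      by (rule diff_card_le_card_Diff) (use card_mate_mate(2) x y in auto)
    moreover have "V - ?S = good y" by (auto simp: good_def)
    ultimately have "k * n - (2 + k * k + k * k) \<le> card (good y)" using ab by simp
    then show ?thesis using kn_large k2 by linarith
  qed
  have R_card: "card (R y) \<le> k * n * (k * k)" "finite (R y)" if "y \<in> M" for y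
  proof -
    have eq: "R y = (SIGMA u:V. {v. \<exists>w. mate x u w \<and> mate y w v})" by (auto simp: R_def)
    have "card (R y) = (\<Sum>u\<in>V. card {v. \<exists>w. mate x u w \<and> mate y w v})"
      unfolding eq by (intro card_SigmaI) (use card_mate_mate(2)[OF x that] in auto)
    also have "\<dots> \<le> (\<Sum>u\<in>V. k * k)" by (intro sum_mono card_mate_mate x that)
    finally show "card (R y) \<le> k * n * (k * k)" by simp
    show "finite (R y)" unfolding eq using card_mate_mate(2)[OF x that] by (intro finite_SigmaI) auto
  qed
  have "\<Phi> ` Sigma E good \<subseteq> Sigma (A t) R"
  proof
    fix z assume "z \<in> \<Phi> ` Sigma E good"
    then obtain y v where z: "z = \<Phi> (y, v)" and y: "y \<in> E" and v: "v \<in> good y" by auto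
    obtain w where w: "(r y, w) \<in> Z y" using r[OF y] by blast
    let ?u = "r y"
    let ?y = "relabel (transpose ?u v) y"
    have u: "?u \<in> V - {a, b}" "w \<noteq> ?u" "mate x ?u w" "mate y ?u w" using w by (auto simp: Z W)
    have v': "v \<in> V - {a, b}" "\<And>w. mate y ?u w \<Longrightarrow> \<not> mate x w v" "\<And>w. mate x ?u w \<Longrightarrow> \<not> mate y w v"
      using v by (auto simp: good_def)
    have yX: "y \<in> X" using y by (auto simp: E_def A_def)
    have y'X: "?y \<in> X" using X u v' yX by (auto simp: stable_def)
    have vu: "v \<noteq> w" using v' u by (metis mate_refl x mate_sym DiffD1)
    have ux: "\<not> mate x ?u v" using v'(2)[of ?u] u mate_refl[OF XM[OF yX]] by auto
    \<comment> \<open>Both moved points are free of obstructions afterwards, so no obstructing pair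
      arises and the selected one disappears.\<close>
    have clean: "\<not> (mate x p q \<and> mate ?y p q)" if "p \<in> {?u, v}" "p \<noteq> q" for p q
    proof
      assume "mate x p q \<and> mate ?y p q"
      then have pq: "mate x p q" "mate y (transpose ?u v p) (transpose ?u v q)"
        by (simp_all only: mate_transpose)
      from that(1) consider "p = ?u" | "p = v" by blast
      then show False
      proof cases
        case 1
        then have "q \<noteq> v" using pq(1) ux by auto
        then have "mate y v q" using pq(2) 1 that(2) by simp
        then show False using v'(3)[of q] pq(1) 1 by (simp add: mate_sym)
      next
        case 2
        then have "q \<noteq> ?u" using pq(1) ux by (auto simp: mate_sym)
        then have "mate y ?u q" using pq(2) 2 that(2) by simp
        then show False using v'(2)[of q] pq(1) 2 by (simp add: mate_sym)
      qed
    qed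
    have "Z ?y \<subset> Z y"
    proof
      show "Z ?y \<subseteq> Z y"
      proof
        fix pq assume pq: "pq \<in> Z ?y"
        obtain p q where [simp]: "pq = (p, q)" by (cases pq)
        have "mate x p q" "mate ?y p q" "p \<noteq> q" using pq by (auto simp: Z W)
        then have "p \<notin> {?u, v}" "q \<notin> {?u, v}" using clean[of p q] clean[of q p] by (auto simp: mate_sym)
        then have "mate y p q" using \<open>mate ?y p q\<close> by (simp add: mate_transpose_fixed)
        then show "pq \<in> Z y" using pq by (auto simp: Z)
      qed
      show "Z ?y \<noteq> Z y"
      proof
        assume "Z ?y = Z y"
        then have "(?u, w) \<in> Z ?y" using w by simp
        then show False using clean[of ?u w] by (auto simp: Z W)
      qed
    qed
    then have "card (Z ?y) < card (Z y)" using finZ by (intro psubset_card_mono)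
    then have "?y \<in> A t" using y y'X by (auto simp: A_def E_def)
    moreover have "mate ?y w v" using u(2,4) vu by (simp add: mate_transpose mate_sym)
    ultimately show "z \<in> Sigma (A t) R" using u by (auto simp: z \<Phi>_def R_def)
  qed
  moreover have "inj_on \<Phi> (Sigma E good)"
  proof (rule inj_on_inverseI[where g = "\<lambda>(y, (u, v)). (relabel (transpose u v) y, v)"])
    fix z show "(\<lambda>(y, (u, v)). (relabel (transpose u v) y, v)) (\<Phi> z) = z"
      by (cases z) (simp only: \<Phi>_def prod.case relabel_transpose_twice)
  qed
  moreover have "finite (Sigma (A t) R)"
    using finX R_card(2) XM by (intro finite_SigmaI) (auto simp: A_def)
  ultimately have le: "card (Sigma E good) \<le> card (Sigma (A t) R)"
    by (metis card_image card_mono)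
  have "card E * (k * n) \<le> 2 * (\<Sum>y\<in>E. card (good y))"
    unfolding sum_distrib_left using sum_mono[of E "\<lambda>_. k * n" "\<lambda>y. 2 * card (good y)"] good_card by simp
  also have "(\<Sum>y\<in>E. card (good y)) = card (Sigma E good)"
    using finX by (intro card_SigmaI[symmetric]) (auto simp: E_def A_def good_def)
  also note le
  also have "card (Sigma (A t) R) = (\<Sum>y\<in>A t. card (R y))"
    using finX R_card(2) XM by (intro card_SigmaI) (auto simp: A_def)
  also have "\<dots> \<le> (\<Sum>y\<in>A t. k * n * (k * k))"
    by (intro sum_mono R_card) (auto simp: A_def XM)
  finally have "k * n * card E \<le> k * n * (2 * k\<^sup>2 * card (A t))"
    by (simp add: power2_eq_square algebra_simps)
  then have "card E \<le> 2 * k\<^sup>2 * card (A t)" using n_large k2 by simp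
  moreover have "card (A (Suc t)) = card E + card (A t)"
  proof -
    have "A t \<subseteq> A (Suc t)" by (auto simp: A_def)
    then show ?thesis unfolding E_def
      using finX card_mono[of "A (Suc t)" "A t"] by (simp add: card_Diff_subset A_def)
  qed
  ultimately show ?thesis by (simp add: A_def)
qed

text \<open>By \<open>pair_count_bound\<close> the average number of obstructing pairs is at most
  \<open>2 * k\<^sup>2\<close>. By Markov's inequality half of \<open>X\<close> has at most
  \<open>4 * k\<^sup>2\<close> of them, and \<open>switching_step\<close> brings this number down to
  zero one at a time.\<close>

lemma skew_fraction:
  assumes x: "x \<in> M" and X: "stable a b X" and ab: "a \<noteq> b"
    and apart: "\<And>y. y \<in> X \<Longrightarrow> \<not> (mate x a b \<and> mate y a b)"
  shows "card X \<le> skew_const k * card {y\<in>X. skew x y}"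
proof -
  define W where "W = {(u, w). u \<in> V - {a, b} \<and> w \<noteq> u \<and> mate x u w}"
  define Z where "Z y = {p\<in>W. mate y (fst p) (snd p)}" for y
  define A where "A s = {y\<in>X. card (Z y) \<le> s}" for s
  have finX: "finite X" using X by (rule stable_finite)
  have finW: "finite W" by (rule finite_subset[of _ "V \<times> V"]) (use mateD[OF x] W_def in auto)
  have finZ: "finite (Z y)" for y using finW by (simp add: Z_def)
  \<comment> \<open>The only pair of points that \<open>W\<close> misses in both orders is
    \<open>{a, b}\<close>, and \<open>apart\<close> rules it out as an obstruction.\<close>
  have A0: "A 0 = {y\<in>X. skew x y}"
  proof -
    have "Z y = {} \<longleftrightarrow> skew x y" if "y \<in> X" for y
    proof
      assume Z: "Z y = {}"
      show "skew x y" unfolding skew_def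
      proof safe
        fix p q assume pq: "mate x p q" "mate y p q"
        show "p = q"
        proof (rule ccontr)
          assume ne: "p \<noteq> q"
          have "p \<in> V" "q \<in> V" using mateD[OF x] pq by auto
          then have "p \<in> {a, b}" "q \<in> {a, b}"
            using Z ne pq by (force simp: Z_def W_def, force simp: Z_def W_def mate_sym)
          then show False using ne apart[OF that] pq by (auto simp: mate_sym)
        qed
      qed
    qed (auto simp: Z_def W_def skew_def)
    then show ?thesis using finZ by (auto simp: A_def)
  qed
  have cardW: "card W \<le> k * n * k"
  proof -
    have sub: "W \<subseteq> (SIGMA u:V. {w. mate x u w})" by (auto simp: W_def)
    have "card W \<le> card (SIGMA u:V. {w. mate x u w})"
      using finite_mates[OF x] by (intro card_mono sub finite_SigmaI) auto
    also have "\<dots> = (\<Sum>u\<in>V. card {w. mate x u w})"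
      using finite_mates[OF x] by (intro card_SigmaI) auto
    also have "\<dots> \<le> (\<Sum>u\<in>V. k)" by (intro sum_mono card_mates_le x)
    finally show ?thesis by simp
  qed
  have "(k * n - 3) * (\<Sum>y\<in>X. card (Z y)) = (\<Sum>p\<in>W. (k * n - 3) * card {y\<in>X. mate y (fst p) (snd p)})"
    unfolding Z_def sum_distrib_left[symmetric] by (subst sum_card_swap) (use finX finW in auto)
  also have "\<dots> \<le> (\<Sum>p\<in>W. k * card X)"
    by (intro sum_mono pair_count_bound[OF X]) (auto simp: W_def)
  also have "\<dots> \<le> k * n * k * (k * card X)" using cardW by simp
  also have "\<dots> \<le> 2 * (k * n - 3) * k * (k * card X)"
  proof -
    have "k * n \<le> 2 * (k * n - 3)" using kn_large k2 by linarith
    from mult_le_mono1[OF mult_le_mono1[OF this]] show ?thesis .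
  qed
  also have "\<dots> = (k * n - 3) * (2 * k\<^sup>2 * card X)" by (simp add: power2_eq_square mult_ac)
  finally have avg: "(\<Sum>y\<in>X. card (Z y)) \<le> 2 * k\<^sup>2 * card X"
    using kn_large k2 by (subst (asm) mult_le_cancel1) linarith
  have "4 * k\<^sup>2 * card (X - A (4 * k\<^sup>2)) \<le> (\<Sum>y\<in>X - A (4 * k\<^sup>2). card (Z y))"
  proof -
    have "(\<Sum>y\<in>X - A (4 * k\<^sup>2). 4 * k\<^sup>2) \<le> (\<Sum>y\<in>X - A (4 * k\<^sup>2). card (Z y))"
      by (intro sum_mono) (auto simp: A_def)
    then show ?thesis by (simp add: mult.commute)
  qed
  also have "\<dots> \<le> (\<Sum>y\<in>X. card (Z y))" using finX by (intro sum_mono2) auto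
  finally have "2 * k\<^sup>2 * (2 * card (X - A (4 * k\<^sup>2))) \<le> 2 * k\<^sup>2 * card X" using avg by linarith
  then have "2 * card (X - A (4 * k\<^sup>2)) \<le> card X" using k2 by simp
  moreover have "card (X - A (4 * k\<^sup>2)) = card X - card (A (4 * k\<^sup>2))" "card (A (4 * k\<^sup>2)) \<le> card X"
    using finX by (auto simp: A_def intro!: card_Diff_subset card_mono)
  ultimately have half: "card X \<le> 2 * card (A (4 * k\<^sup>2))" by linarith
  have "card (A t) \<le> (1 + 2 * k\<^sup>2) ^ t * card (A 0)" for t
  proof (induction t)
    case (Suc t)
    have "card (A (Suc t)) \<le> (1 + 2 * k\<^sup>2) * card (A t)"
      unfolding A_def by (rule switching_step[OF x X ab W_def Z_def])
    also have "\<dots> \<le> (1 + 2 * k\<^sup>2) * ((1 + 2 * k\<^sup>2) ^ t * card (A 0))" using Suc by (rule mult_le_mono2)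
    finally show ?case by (simp only: power_Suc mult.assoc)
  qed simp
  from this[of "4 * k\<^sup>2"] half show ?thesis by (simp add: A0 skew_const_def)
qed

section \<open>Transitivity of the relabelling action\<close>

text \<open>Blocks are matched one by one in an arbitrary order. The prescribed map \<open>g\<close>
  carries what has been built so far, which is why it is general in the induction.\<close>

lemma extend_bij_blocks:
  assumes "finite x" "finite x'" "disjoint x" "disjoint x'" "card x = card x'" "\<forall>e\<in>x \<union> x'. card e = k"
    "bij_betw g A A'" "A \<inter> \<Union>x = {}" "A' \<inter> \<Union>x' = {}"
  shows "\<exists>\<sigma>. bij_betw \<sigma> (A \<union> \<Union>x) (A' \<union> \<Union>x') \<and> (\<forall>v\<in>A. \<sigma> v = g v) \<and> relabel \<sigma> x = x'"
  using assms
proof (induction x arbitrary: x' g A A' rule: finite_induct)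
  case empty
  then show ?case by auto
next
  case (insert e x)
  have "x' \<noteq> {}" using insert.hyps insert.prems(4) by auto
  then obtain e' where e': "e' \<in> x'" by blast
  have "finite e" "finite e'" "card e = card e'"
    using insert.prems(5) e' k2 by (auto intro: card_ge_0_finite)
  then obtain h where h: "bij_betw h e e'" using finite_same_card_bij by blast
  define g' where "g' v = (if v \<in> e then h v else g v)" for v
  have disj: "A \<inter> e = {}" "A' \<inter> e' = {}" using insert.prems(7,8) e' by auto
  have "bij_betw g' A A'" using insert.prems(6) disj
    by (subst bij_betw_cong[of A g' g]) (auto simp: g'_def)
  moreover have "bij_betw g' e e'" using h by (subst bij_betw_cong[of e g' h]) (auto simp: g'_def)
  ultimately have g': "bij_betw g' (A \<union> e) (A' \<union> e')" using disj(2) by (rule bij_betw_combine)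
  have "\<exists>\<sigma>. bij_betw \<sigma> ((A \<union> e) \<union> \<Union>x) ((A' \<union> e') \<union> \<Union>(x' - {e'})) \<and>
    (\<forall>v\<in>A \<union> e. \<sigma> v = g' v) \<and> relabel \<sigma> x = x' - {e'}"
  proof (rule insert.IH[OF _ _ _ _ _ g'])
    show "card x = card (x' - {e'})" using insert.hyps insert.prems(4) e' insert.prems(1) by simp
    show "disjoint x" "disjoint (x' - {e'})" using insert.prems(2,3) by (auto simp: disjoint_def)
    show "(A \<union> e) \<inter> \<Union>x = {}" using insert.prems(2,7) insert.hyps by (auto simp: disjoint_def)
    show "(A' \<union> e') \<inter> \<Union>(x' - {e'}) = {}" using insert.prems(3,8) e' by (auto simp: disjoint_def)
  qed (use insert.prems in auto)
  then obtain \<sigma> where \<sigma>: "bij_betw \<sigma> ((A \<union> e) \<union> \<Union>x) ((A' \<union> e') \<union> \<Union>(x' - {e'}))"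
    "\<forall>v\<in>A \<union> e. \<sigma> v = g' v" "relabel \<sigma> x = x' - {e'}" by blast
  have "\<sigma> ` e = e'" using \<sigma>(2) h by (auto simp: g'_def bij_betw_def)
  then have "relabel \<sigma> (insert e x) = x'" using \<sigma>(3) e' by auto
  moreover have "\<forall>v\<in>A. \<sigma> v = g v" using \<sigma>(2) disj by (auto simp: g'_def)
  moreover have "(A \<union> e) \<union> \<Union>x = A \<union> \<Union>(insert e x)" "(A' \<union> e') \<union> \<Union>(x' - {e'}) = A' \<union> \<Union>x'"
    using e' by auto
  ultimately show ?case using \<sigma>(1) by auto
qed

text \<open>The blocks of \<open>a\<close> and \<open>b\<close> coincide in both hypermatchings or
  in neither, so they can be matched first by a bijection fixing \<open>a\<close> and
  \<open>b\<close>. The other blocks are then matched arbitrarily.\<close>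

lemma transitive:
  assumes x: "x \<in> M" and x': "x' \<in> M" and ab: "a \<in> V" "b \<in> V"
    and iff: "mate x a b \<longleftrightarrow> mate x' a b"
  obtains \<sigma> where "\<sigma> permutes V - {a, b}" "relabel \<sigma> x = x'"
proof -
  have block: "\<exists>e\<in>m. v \<in> e" if "m \<in> M" "v \<in> V" for m v
    using mate_refl[OF that] by (auto simp: mate_def)
  obtain ea eb where e: "ea \<in> x" "a \<in> ea" "eb \<in> x" "b \<in> eb" using block[OF x] ab by metis
  obtain ea' eb' where e': "ea' \<in> x'" "a \<in> ea'" "eb' \<in> x'" "b \<in> eb'" using block[OF x'] ab by metis
  have fin: "finite c" "card c = k" if "c \<in> x \<union> x'" for c
    using that x x' k2 by (auto simp: M_iff intro: card_ge_0_finite)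
  have dx: "disjoint x" and dx': "disjoint x'" and Ux: "\<Union>x = V" and Ux': "\<Union>x' = V"
    and fx: "finite x" "finite x'" and cards: "card x = card x'"
    using x x' by (auto simp: M_iff partition_on_def intro: finite_UnionD)
  have same_block: "c = d \<longleftrightarrow> mate m a b" if m: "m \<in> M" "c \<in> m" "a \<in> c" "d \<in> m" "b \<in> d" for m c d
  proof -
    have "mate m a b \<longleftrightarrow> b \<in> c" using mates_eq_block[OF m(1-3)] by blast
    moreover have "c = d" if "b \<in> c"
      using mates_eq_block[OF m(1,2) that] mates_eq_block[OF m(1,4,5)] by simp
    ultimately show ?thesis using m(5) by blast
  qed
  have eq: "ea = eb \<longleftrightarrow> mate x a b" "ea' = eb' \<longleftrightarrow> mate x' a b"
    by (rule same_block[OF x e], rule same_block[OF x' e'])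
  have "\<exists>g. bij_betw g (ea \<union> eb) (ea' \<union> eb') \<and> g a = a \<and> g b = b \<and> g ` ea = ea' \<and> g ` eb = eb'"
  proof (cases "ea = eb")
    case True
    then have [simp]: "ea' = eb'" using eq iff by simp
    obtain g where "bij_betw g ea ea'" "\<And>s. s \<in> {a, b} \<Longrightarrow> g s = s"
      using bij_betw_fixing[of ea ea' "{a, b}"] fin e e' True by auto
    then show ?thesis using True by (auto simp: bij_betw_def)
  next
    case False
    then have ne: "ea' \<noteq> eb'" using eq iff by simp
    have disj: "ea \<inter> eb = {}" "ea' \<inter> eb' = {}"
      using False ne e e' dx dx' by (auto simp: disjoint_def)
    obtain g1 where g1: "bij_betw g1 ea ea'" "\<And>s. s \<in> {a} \<Longrightarrow> g1 s = s"
      using bij_betw_fixing[of ea ea' "{a}"] fin e e' by auto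
    obtain g2 where g2: "bij_betw g2 eb eb'" "\<And>s. s \<in> {b} \<Longrightarrow> g2 s = s"
      using bij_betw_fixing[of eb eb' "{b}"] fin e e' by auto
    define g where "g v = (if v \<in> ea then g1 v else g2 v)" for v
    have 1: "bij_betw g ea ea'" using g1(1) by (subst bij_betw_cong[of ea g g1]) (auto simp: g_def)
    have 2: "bij_betw g eb eb'" using g2(1) disj by (subst bij_betw_cong[of eb g g2]) (auto simp: g_def)
    have "bij_betw g (ea \<union> eb) (ea' \<union> eb')" using 1 2 disj(2) by (rule bij_betw_combine)
    moreover have "g a = a" "g b = b" using g1(2) g2(2) e disj by (auto simp: g_def)
    ultimately show ?thesis using 1 2 by (auto simp: bij_betw_def)
  qed
  then obtain g where g: "bij_betw g (ea \<union> eb) (ea' \<union> eb')" "g a = a" "g b = b" "g ` ea = ea'" "g ` eb = eb'"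
    by blast
  have "\<exists>\<sigma>. bij_betw \<sigma> ((ea \<union> eb) \<union> \<Union>(x - {ea, eb})) ((ea' \<union> eb') \<union> \<Union>(x' - {ea', eb'})) \<and>
      (\<forall>v\<in>ea \<union> eb. \<sigma> v = g v) \<and> relabel \<sigma> (x - {ea, eb}) = x' - {ea', eb'}"
  proof (rule extend_bij_blocks[OF _ _ _ _ _ _ g(1)])
    have "card {ea, eb} = card {ea', eb'}" using eq iff by (simp add: card_insert_if)
    then show "card (x - {ea, eb}) = card (x' - {ea', eb'})"
      using e e' cards by (simp add: card_Diff_subset)
    show "(ea \<union> eb) \<inter> \<Union>(x - {ea, eb}) = {}" "(ea' \<union> eb') \<inter> \<Union>(x' - {ea', eb'}) = {}"
      by (intro disjoint_pair_rest dx dx' e e')+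
  qed (use fx dx dx' fin in \<open>auto simp: disjoint_def\<close>)
  moreover have "(ea \<union> eb) \<union> \<Union>(x - {ea, eb}) = V" "(ea' \<union> eb') \<union> \<Union>(x' - {ea', eb'}) = V"
    using disjoint_pair_rest(2) dx dx' e(1,3) e'(1,3) Ux Ux' by metis+
  ultimately obtain \<sigma> where \<sigma>: "bij_betw \<sigma> V V" "\<forall>v\<in>ea \<union> eb. \<sigma> v = g v"
    "relabel \<sigma> (x - {ea, eb}) = x' - {ea', eb'}" by auto
  have "\<sigma> ` ea = ea'" "\<sigma> ` eb = eb'" using \<sigma>(2) g(4,5) by auto
  then have rel: "relabel \<sigma> x = x'"
  proof -
    have "x = insert ea (insert eb (x - {ea, eb}))" using e by auto
    then have "relabel \<sigma> x = insert (\<sigma> ` ea) (insert (\<sigma> ` eb) (relabel \<sigma> (x - {ea, eb})))" by (metis image_insert)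
    then show ?thesis using \<open>\<sigma> ` ea = ea'\<close> \<open>\<sigma> ` eb = eb'\<close> \<sigma>(3) e' by auto
  qed
  \<comment> \<open>Nothing is known about \<open>\<sigma>\<close> outside \<open>V\<close>; a
    permutation of \<open>V\<close> has to be the identity there.\<close>
  define \<rho> where "\<rho> v = (if v \<in> V then \<sigma> v else v)" for v
  have "bij_betw \<rho> V V" using \<sigma>(1) by (subst bij_betw_cong[of V \<rho> \<sigma>]) (auto simp: \<rho>_def)
  then have "\<rho> permutes V" by (rule bij_imp_permutes) (auto simp: \<rho>_def)
  then have "\<rho> permutes V - {a, b}"
    by (rule permutes_superset) (use \<sigma>(2) g(2,3) e in \<open>auto simp: \<rho>_def\<close>)
  moreover have "relabel \<rho> x = relabel \<sigma> x"
    by (intro image_cong refl) (use Ux in \<open>auto simp: \<rho>_def\<close>)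
  ultimately show ?thesis using that rel by simp
qed

text \<open>A permutation is a product of transpositions, and each of them is a move inside
  \<open>X\<close>. Together with transitivity this gives the connectedness that the mixing estimate
  requires.\<close>

lemma stable_connected:
  assumes X: "stable a b X" and "\<sigma> permutes V - {a, b}" "x \<in> X"
  shows "relabel \<sigma> x \<in> X \<and> (x, relabel \<sigma> x) \<in>
    {(x, relabel (transpose (fst i) (snd i)) x) |x i. x \<in> X \<and> i \<in> (V - {a, b}) \<times> (V - {a, b})}\<^sup>*"
    (is "_ \<and> _ \<in> ?R\<^sup>*")
  using assms(2)
proof (rule permutes_induct)
  show "finite (V - {a, b})" by simp
next
  show "relabel id x \<in> X \<and> (x, relabel id x) \<in> ?R\<^sup>*" using assms(3) by simp
next
  fix u v p
  assume u: "u \<in> V - {a, b}" "v \<in> V - {a, b}" and p: "relabel p x \<in> X \<and> (x, relabel p x) \<in> ?R\<^sup>*"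
  let ?y = "relabel (transpose u v) (relabel p x)"
  have y: "?y \<in> X" using X u p by (auto simp: stable_def)
  have step: "(relabel p x, ?y) \<in> ?R"
    by (rule CollectI, rule exI[of _ "relabel p x"], rule exI[of _ "(u, v)"])
      (use u p in \<open>simp only: fst_conv snd_conv mem_Sigma_iff simp_thms\<close>)
  have "(x, ?y) \<in> ?R\<^sup>*" by (rule rtrancl_into_rtrancl[OF conjunct2[OF p] step])
  with y show "relabel (transpose u v \<circ> p) x \<in> X \<and> (x, relabel (transpose u v \<circ> p) x) \<in> ?R\<^sup>*"
    unfolding relabel_comp[symmetric] by (rule conjI)
qed

text \<open>Relabelling by \<open>\<sigma>\<close> is a bijection of \<open>Y\<close> that preserves
  skewness. With transitivity it makes the skewness graphs regular.\<close>

lemma skew_degree_relabel: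
  assumes Y: "stable a b Y" and \<sigma>: "\<sigma> permutes V - {a, b}"
  shows "card {y\<in>Y. skew (relabel \<sigma> x) y} = card {y\<in>Y. skew x y}"
proof (rule bij_betw_same_card[symmetric], rule bij_betw_byWitness[where f' = "relabel (inv \<sigma>)"])
  have inv: "relabel (inv \<sigma>) (relabel \<sigma> y) = y" "relabel \<sigma> (relabel (inv \<sigma>) y) = y" for y
    unfolding relabel_comp permutes_inv_o[OF \<sigma>] by simp_all
  have Y': "relabel \<sigma> y \<in> Y" "relabel (inv \<sigma>) y \<in> Y" if "y \<in> Y" for y
    using stable_connected[OF Y _ that] \<sigma> permutes_inv[OF \<sigma>] by blast+
  have b: "bij \<sigma>" using \<sigma> by (rule permutes_bij)
  have sk: "skew x (relabel (inv \<sigma>) y) \<longleftrightarrow> skew (relabel \<sigma> x) y" for y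
    using skew_relabel[OF b, of x "relabel (inv \<sigma>) y"] by (simp only: inv)
  show "\<forall>y\<in>{y \<in> Y. skew x y}. relabel (inv \<sigma>) (relabel \<sigma> y) = y"
    by (rule ballI, rule inv(1))
  show "\<forall>y\<in>{y \<in> Y. skew (relabel \<sigma> x) y}. relabel \<sigma> (relabel (inv \<sigma>) y) = y"
    by (rule ballI, rule inv(2))
  show "relabel \<sigma> ` {y \<in> Y. skew x y} \<subseteq> {y \<in> Y. skew (relabel \<sigma> x) y}"
    by (rule image_subsetI) (simp only: mem_Collect_eq skew_relabel[OF b] Y'(1) simp_thms)
  show "relabel (inv \<sigma>) ` {y \<in> Y. skew (relabel \<sigma> x) y} \<subseteq> {y \<in> Y. skew x y}"
    by (rule image_subsetI) (simp only: mem_Collect_eq sk Y'(2) simp_thms)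
qed

lemma transitive_M:
  assumes "x \<in> M" "x' \<in> M"
  obtains \<sigma> where "\<sigma> permutes V" "relabel \<sigma> x = x'"
proof -
  have "1 \<in> V" using n_large k2 by auto
  \<comment> \<open>The choice \<open>a = b = 1\<close> satisfies the hypothesis on mates by
    reflexivity.\<close>
  moreover have "mate x 1 1" "mate x' 1 1" using assms mate_refl \<open>1 \<in> V\<close> by auto
  ultimately obtain \<sigma> where "\<sigma> permutes V - {1, 1}" "relabel \<sigma> x = x'"
    using transitive[OF assms, of 1 1] by auto
  then show ?thesis using that permutes_subset[of \<sigma> "V - {1, 1}" V] by auto
qed

text \<open>Transitivity makes the left-hand sum independent of \<open>x0\<close>, so it may be
  averaged over \<open>M\<close>, where each relabelling acts as a bijection. Concentration for
  permutations is thereby carried over to a uniformly random hypermatching.\<close>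

lemma sum_over_relabellings:
  fixes \<phi> :: "nat set set \<Rightarrow> real"
  assumes x0: "x0 \<in> M"
  shows "card M * (\<Sum>\<sigma> | \<sigma> permutes V. \<phi> (relabel \<sigma> x0)) = fact (k * n) * (\<Sum>x\<in>M. \<phi> x)"
proof -
  have same: "(\<Sum>\<sigma> | \<sigma> permutes V. \<phi> (relabel \<sigma> x)) = (\<Sum>\<sigma> | \<sigma> permutes V. \<phi> (relabel \<sigma> x0))"
    if x: "x \<in> M" for x
  proof -
    obtain \<rho> where \<rho>: "\<rho> permutes V" "relabel \<rho> x0 = x" using transitive_M[OF x0 x] .
    have "(\<Sum>\<sigma> | \<sigma> permutes V. \<phi> (relabel \<sigma> x0)) = (\<Sum>\<sigma> | \<sigma> permutes V. \<phi> (relabel (\<sigma> \<circ> \<rho>) x0))"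
      by (rule sum_permutations_compose_right[OF \<rho>(1)])
    then show ?thesis unfolding relabel_comp[symmetric] \<rho>(2) ..
  qed
  have perm: "(\<Sum>x\<in>M. \<phi> (relabel \<sigma> x)) = (\<Sum>x\<in>M. \<phi> x)" if \<sigma>: "\<sigma> permutes V" for \<sigma>
  proof (rule sum.reindex_bij_witness[where i = "relabel (inv \<sigma>)" and j = "relabel \<sigma>"])
    show "relabel (inv \<sigma>) (relabel \<sigma> y) = y" "relabel \<sigma> (relabel (inv \<sigma>) y) = y" for y
      unfolding relabel_comp permutes_inv_o[OF \<sigma>] by simp_all
    show "relabel \<sigma> y \<in> M" "relabel (inv \<sigma>) y \<in> M" if "y \<in> M" for y
      using relabel_in_M that \<sigma> permutes_inv by blast+
  qed simp
  have "card M * (\<Sum>\<sigma> | \<sigma> permutes V. \<phi> (relabel \<sigma> x0)) = (\<Sum>x\<in>M. \<Sum>\<sigma> | \<sigma> permutes V. \<phi> (relabel \<sigma> x))"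
  proof -
    have "(\<Sum>x\<in>M. \<Sum>\<sigma> | \<sigma> permutes V. \<phi> (relabel \<sigma> x))
        = (\<Sum>x\<in>M. \<Sum>\<sigma> | \<sigma> permutes V. \<phi> (relabel \<sigma> x0))"
      by (rule sum.cong[OF refl same])
    then show ?thesis by simp
  qed
  also have "\<dots> = (\<Sum>\<sigma> | \<sigma> permutes V. \<Sum>x\<in>M. \<phi> (relabel \<sigma> x))" by (rule sum.swap)
  also have "\<dots> = (\<Sum>\<sigma> | \<sigma> permutes V. \<Sum>x\<in>M. \<phi> x)" by (intro sum.cong refl perm) simp
  also have "\<dots> = fact (k * n) * (\<Sum>x\<in>M. \<phi> x)"
  proof -
    have "card {\<sigma>. \<sigma> permutes V} = fact (k * n)" by (rule card_permutations) simp_all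
    then show ?thesis by simp
  qed
  finally show ?thesis .
qed

section \<open>Largest intersecting families\<close>

text \<open>Reciprocal of the share of \<open>F\<close> that some pair must attain, adjusted so that
  the scaled counting function in \<open>heavy_pair\<close> changes by at most
  \<open>1 / (2 * sqrt (k * n))\<close> under a transposition.\<close>

definition heavy_factor :: real where
  "heavy_factor = 8 * k * skew_const k * ln (2 * n) * sqrt (k * n)"

text \<open>The relative loss of skew partners under a transposition: \<open>2 * k\<close> canonical
  families, each with a share of at most \<open>2 / n\<close>, times \<open>skew_const k\<close> for
  passing from the whole class to the skew partners.\<close>

definition mixing_rate :: real where
  "mixing_rate = 4 * real k * real (skew_const k) / real n"

lemma skew_const_pos: "skew_const k > 0"
  by (simp add: skew_const_def)

lemma heavy_factor_pos: "heavy_factor > 0"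
  unfolding heavy_factor_def using k2 n_large skew_const_pos by (intro mult_pos_pos) auto

section \<open>A pair shared by many members of the family\<close>

lemma exists_apart:
  assumes "x \<in> M"
  obtains a b where "a \<in> V" "b \<in> V" "a \<noteq> b" "\<not> mate x a b"
proof -
  have a: "1 \<in> V" using n_large k2 by auto
  have "card {v. mate x 1 v} < card V"
    using card_mates_le[OF assms, of 1] kn_large k2 by (simp del: One_nat_def)
  then have "\<not> V \<subseteq> {v. mate x 1 v}" using card_mono[OF finite_mates[OF assms]] by (meson not_le)
  then obtain b where "b \<in> V" "\<not> mate x 1 b" by blast
  then show ?thesis using that[OF a] mate_refl[OF assms a] by metis
qed

text \<open>Exponential moment method for the lower tail. If all pairs were light,
  \<open>exp (- s * h)\<close> would have a mean within a factor \<open>exp 1\<close> of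
  \<open>exp (- s * \<mu>)\<close>, whereas it equals 1 on all of \<open>F\<close>.\<close>

lemma heavy_pair:
  assumes F: "F \<subseteq> M" "F \<noteq> {}" and inter: "\<And>x y. x \<in> F \<Longrightarrow> y \<in> F \<Longrightarrow> \<not> skew x y"
    and large: "card M \<le> 2 * n * card F"
  shows "\<exists>u\<in>V. \<exists>v\<in>V. u \<noteq> v \<and> card F \<le> heavy_factor * card {y\<in>F. mate y u v}"
proof (rule ccontr)
  assume contr: "\<not> (\<exists>u\<in>V. \<exists>v\<in>V. u \<noteq> v \<and> card F \<le> heavy_factor * card {y\<in>F. mate y u v})"
  have light: "heavy_factor * card {y\<in>F. mate y u v} < card F" if "u \<in> V" "v \<in> V" "u \<noteq> v" for u v
    using contr that not_le by blast
  have finF: "finite F" using F(1) finite_M by (rule finite_subset)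
  have cF: "real (card F) > 0" using F finF by (simp add: card_gt_0_iff)
  define B where "B = card F / heavy_factor"
  have B: "real (card {y\<in>F. mate y u q}) \<le> B" if "u \<in> V" "q \<noteq> u" for u q
  proof (cases "q \<in> V")
    case True
    then show ?thesis using light[of u q] that heavy_factor_pos 
      by (simp add: B_def pos_le_divide_eq mult.commute)
  next
    case False
    then have "{y\<in>F. mate y u q} = {}" using mateD F(1) by blast
    then have "card {y\<in>F. mate y u q} = 0" by (simp only: card.empty)
    then show ?thesis using heavy_factor_pos by (simp only: B_def) simp
  qed
  obtain x0 where x0: "x0 \<in> F" using F(2) by blast
  then have x0M: "x0 \<in> M" using F(1) by blast
  define C where "C = real (skew_const k)"
  have C: "C > 0" using skew_const_pos by (simp add: C_def)
  define d where "d = card {y\<in>M. skew x0 y}"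
  have deg: "card {y\<in>M. skew x y} = d" if x: "x \<in> M" for x
  proof -
    obtain \<sigma> where \<sigma>: "\<sigma> permutes V" "relabel \<sigma> x0 = x" using transitive_M[OF x0M x] .
    have "stable 0 0 M" "V - {0, 0} = V" by (auto simp: stable_M)
    from skew_degree_relabel[OF this(1), unfolded this(2), OF \<sigma>(1), of x0] show ?thesis
      by (simp only: \<sigma>(2) d_def)
  qed
  have "card M \<le> skew_const k * d"
  proof -
    \<comment> \<open>A pair that is apart in \<open>x0\<close> makes the hypothesis of
      \<open>skew_fraction\<close> hold on all of \<open>M\<close>.\<close>
    obtain a b where "a \<noteq> b" "\<not> mate x0 a b" using exists_apart[OF x0M] .
    then show ?thesis unfolding d_def by (intro skew_fraction[OF x0M stable_M, of a b]) auto
  qed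
  then have d: "real (card M) \<le> C * d" unfolding C_def by (metis of_nat_le_iff of_nat_mult)
  have cM: "real (card M) > 0" and Mne: "M \<noteq> {}" using x0M by (auto simp: card_gt_0_iff)
  define h where "h x = real (card {y\<in>F. skew x y})" for x
  define \<mu> where "\<mu> = card F * d / card M"
  have sum_h: "(\<Sum>x\<in>M. h x) = card M * \<mu>"
  proof -
    have "(\<Sum>x\<in>M. card {y\<in>F. skew x y}) = (\<Sum>y\<in>F. card {x\<in>M. skew x y})"
      using finF by (intro sum_card_swap) auto
    also have "\<dots> = (\<Sum>y\<in>F. d)" using deg F(1) by (intro sum.cong refl) (auto simp: skew_sym)
    finally have "(\<Sum>x\<in>M. h x) = card F * d" unfolding h_def by (simp flip: of_nat_sum)
    moreover have "card M * \<mu> = card F * d" unfolding \<mu>_def using Mne by simp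
    ultimately show ?thesis by (simp only:)
  qed
  have half: "h x - h (relabel (transpose u v) x) \<le> 2 * k * B" if "x \<in> M" "u \<in> V" "v \<in> V" for x u v
  proof -
    let ?x = "relabel (transpose u v) x"
    have "card {y\<in>F. skew x y} \<le> card ({y\<in>F. skew ?x y} \<union> {y\<in>F. skew x y \<and> \<not> skew ?x y})"
      using finF by (intro card_mono) auto
    also have "\<dots> \<le> card {y\<in>F. skew ?x y} + card {y\<in>F. skew x y \<and> \<not> skew ?x y}" by (rule card_Un_le)
    finally have "h x \<le> h ?x + card {y\<in>F. skew x y \<and> \<not> skew ?x y}" by (simp add: h_def)
    moreover have "real (card {y\<in>F. skew x y \<and> \<not> skew ?x y}) \<le> 2 * k * B"
      using that F(1) B by (intro skew_change_bound) auto
    ultimately show ?thesis by linarith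
  qed
  have lip: "\<bar>h (relabel (transpose u v) x) - h x\<bar> \<le> 2 * k * B" if "x \<in> M" "u \<in> V" "v \<in> V" for x u v
    using half[OF that] half[OF relabel_transpose_in_M[OF that(2,3,1)] that(2,3)]
    unfolding relabel_transpose_twice by linarith
  \<comment> \<open>Since \<open>d\<close> is at least \<open>card M / C\<close>, this scale gives
    \<open>s * \<mu> \<ge> 2 * ln (2 * n)\<close>.\<close>
  define s where "s = 2 * C * ln (2 * n) / card F"
  \<comment> \<open>For this value the exponent in the concentration bound is exactly 1.\<close>
  define l where "l = 1 / (2 * sqrt (k * n))"
  have "1 \<le> k * n" using kn_large k2 by linarith
  then have kn: "real (k * n) \<ge> 1" by (metis of_nat_1 of_nat_le_iff)
  have ln_pos: "ln (2 * real n) > 0" using n_large by simp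
  have s: "s \<ge> 0" unfolding s_def using C cF ln_pos by simp
  have sl: "s * (2 * k * B) = l"
    using C cF ln_pos k2 kn by (simp add: s_def l_def B_def heavy_factor_def C_def)
  define \<phi> where "\<phi> x = - s * h x" for x
  have avg: "card M * (\<Sum>\<sigma> | \<sigma> permutes V. exp (\<phi> (relabel \<sigma> x0) - (- s * \<mu>)))
      \<le> card M * (fact (k * n) * exp 1)"
  proof -
    have "(\<Sum>\<sigma> | \<sigma> permutes V. exp (\<phi> (relabel \<sigma> x0) - (- s * \<mu>)))
        \<le> fact (card V) * exp (4 * l\<^sup>2 * card V)"
    proof (rule permutation_concentration)
      fix \<sigma> u v assume \<sigma>: "\<sigma> permutes V" "u \<in> V" "v \<in> V"
      have "\<bar>\<phi> (relabel (transpose u v) (relabel \<sigma> x0)) - \<phi> (relabel \<sigma> x0)\<bar>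
          = s * \<bar>h (relabel (transpose u v) (relabel \<sigma> x0)) - h (relabel \<sigma> x0)\<bar>"
        unfolding \<phi>_def right_diff_distrib[symmetric] abs_mult using s by simp
      also have "\<dots> \<le> s * (2 * k * B)"
        by (intro mult_left_mono lip relabel_in_M \<sigma> x0M s)
      finally show "\<bar>\<phi> (relabel (transpose u v \<circ> \<sigma>) x0) - \<phi> (relabel \<sigma> x0)\<bar> \<le> l"
        unfolding relabel_comp sl .
    next
      have "card M * (\<Sum>\<sigma> | \<sigma> permutes V. h (relabel \<sigma> x0)) = card M * (fact (k * n) * \<mu>)"
        unfolding sum_over_relabellings[OF x0M] sum_h by simp
      then have "(\<Sum>\<sigma> | \<sigma> permutes V. h (relabel \<sigma> x0)) = fact (k * n) * \<mu>"
        using Mne by simp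
      then show "(\<Sum>\<sigma> | \<sigma> permutes V. \<phi> (relabel \<sigma> x0)) = fact (card V) * (- s * \<mu>)"
        unfolding \<phi>_def sum_distrib_left[symmetric] by simp
    next
      show "2 * l \<le> 1" using kn unfolding l_def by simp
    qed (simp_all add: l_def)
    also have "4 * l\<^sup>2 * card V = 1" using k2 n_large by (simp add: l_def power_divide)
    finally show ?thesis by (intro mult_left_mono) auto
  qed
  have "card F * exp (s * \<mu>) = (\<Sum>x\<in>F. exp (\<phi> x - (- s * \<mu>)))"
  proof -
    have "h x = 0" if "x \<in> F" for x using inter[OF that] finF by (simp add: h_def)
    then show ?thesis by (simp add: \<phi>_def)
  qed
  also have "\<dots> \<le> (\<Sum>x\<in>M. exp (\<phi> x - (- s * \<mu>)))" by (intro sum_mono2 F(1)) auto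
  finally have "fact (k * n) * (card F * exp (s * \<mu>)) \<le> fact (k * n) * (\<Sum>x\<in>M. exp (\<phi> x - (- s * \<mu>)))"
    by (intro mult_left_mono) auto
  also have "\<dots> \<le> fact (k * n) * (card M * exp 1)"
    using avg sum_over_relabellings[OF x0M, of "\<lambda>x. exp (\<phi> x - (- s * \<mu>))"] by (simp add: mult_ac)
  finally have 1: "card F * exp (s * \<mu>) \<le> card M * exp 1" by simp
  have "2 * ln (2 * n) * card M \<le> 2 * ln (2 * n) * (C * d)"
    using d ln_pos by (intro mult_left_mono) auto
  also have "\<dots> = s * \<mu> * card M" using Mne F(2) finF by (simp add: s_def \<mu>_def)
  finally have "2 * ln (2 * n) \<le> s * \<mu>" using cM by (rule mult_right_le_imp_le)
  then have "exp (2 * ln (2 * n)) \<le> exp (s * \<mu>)" by simp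
  also have "exp (2 * ln (2 * n)) = (2 * real n)\<^sup>2"
    using n_large by (subst exp_double) simp
  finally have "card F * (2 * real n)\<^sup>2 \<le> card F * exp (s * \<mu>)" by (intro mult_left_mono) auto
  also note 1
  also have "real (card M) * exp 1 \<le> real (2 * n * card F) * 3"
  proof (rule mult_mono)
    show "real (card M) \<le> real (2 * n * card F)" using large by (simp only: of_nat_le_iff)
  qed (use exp_le in auto)
  \<comment> \<open>The weight \<open>(2 * n)\<^sup>2\<close> on \<open>F\<close> exceeds the
    reciprocal density \<open>2 * n\<close> by a factor \<open>2 * n\<close>, but only a factor
    below 3 is available.\<close>
  finally have "real (2 * n * card F) * (2 * real n) \<le> real (2 * n * card F) * 3"
    by (simp add: power2_eq_square mult_ac)
  moreover have "real (2 * n * card F) > 0" using cF n_large by simp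
  ultimately have "2 * real n \<le> 3" by (rule mult_left_le_imp_le)
  then show False using n_large by linarith
qed

section \<open>Mixing between the hypermatchings with a pair together and apart\<close>

lemma stable_skew_move:
  assumes x: "x \<in> M" and Y: "stable a b Y" and ab: "a \<noteq> b"
    and apart: "\<And>y. y \<in> Y \<Longrightarrow> \<not> (mate x a b \<and> mate y a b)"
    and uv: "u \<in> V - {a, b}" "v \<in> V - {a, b}"
  shows "real (card {y\<in>Y. skew x y \<and> \<not> skew (relabel (transpose u v) x) y})
    \<le> mixing_rate * card {y\<in>Y. skew x y}"
proof -
  have YM: "Y \<subseteq> M" using Y by (simp add: stable_def)
  define B where "B = 2 * real (card Y) / n"
  have n: "real n > 0" using n_large by simp
  have B: "real (card {y\<in>Y. mate y w q}) \<le> B" if "w \<in> V - {a, b}" "q \<noteq> w" for w q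
  proof -
    have "k * (n * card {y\<in>Y. mate y w q}) \<le> 2 * ((k * n - 3) * card {y\<in>Y. mate y w q})"
    proof -
      have "k * n \<le> 2 * (k * n - 3)" using kn_large k2 by linarith
      from mult_le_mono1[OF this] show ?thesis by (simp only: mult.assoc)
    qed
    also have "\<dots> \<le> k * (2 * card Y)" using pair_count_bound[OF Y that] by simp
    finally have "n * card {y\<in>Y. mate y w q} \<le> 2 * card Y" using k2 by simp
    then have "real n * card {y\<in>Y. mate y w q} \<le> 2 * card Y"
      by (metis of_nat_le_iff of_nat_mult of_nat_numeral)
    then show ?thesis using n by (simp add: B_def pos_le_divide_eq mult.commute)
  qed
  have "real (card {y\<in>Y. skew x y \<and> \<not> skew (relabel (transpose u v) x) y}) \<le> 2 * k * B"
    by (rule skew_change_bound[OF x YM]) (use B uv in auto)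
  also have "\<dots> \<le> 2 * k * (2 * (skew_const k * card {y\<in>Y. skew x y}) / n)"
  proof -
    have "real (card Y) \<le> skew_const k * card {y\<in>Y. skew x y}"
      using skew_fraction[OF x Y ab apart] by (metis of_nat_le_iff of_nat_mult)
    then show ?thesis unfolding B_def by (intro mult_left_mono divide_right_mono) auto
  qed
  finally show ?thesis by (simp add: mixing_rate_def mult_ac)
qed

text \<open>Transpositions avoiding \<open>a\<close> and \<open>b\<close> act on both classes and
  are adjoint with respect to skewness, so the mixing estimate applies with
  \<open>\<kappa> = mixing_rate\<close>. Regularity and connectedness come from transitivity on each
  class.\<close>

lemma together_apart_bound:
  assumes ab: "a \<in> V" "b \<in> V" "a \<noteq> b"
    and f: "f \<subseteq> {y\<in>M. mate y a b}" and g: "g \<subseteq> {y\<in>M. \<not> mate y a b}"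
    and inter: "\<And>x y. x \<in> f \<Longrightarrow> y \<in> g \<Longrightarrow> \<not> skew x y"
  shows "real (card f) * card g \<le> mixing_rate\<^sup>2 *
    (card {y\<in>M. mate y a b} * card {y\<in>M. \<not> mate y a b})"
proof -
  let ?X = "{y\<in>M. mate y a b}" and ?Y = "{y\<in>M. \<not> mate y a b}"
  let ?I = "(V - {a, b}) \<times> (V - {a, b})"
  let ?p = "\<lambda>i. relabel (transpose (fst i) (snd i))"
  have X: "stable a b ?X" and Y: "stable a b ?Y" by (rule stable_together, rule stable_apart)
  show ?thesis
  proof (cases "?X = {} \<or> ?Y = {}")
    case True
    then have "f = {} \<or> g = {}" using f g by blast
    then show ?thesis by auto
  next
    case False
    then obtain x0 y0 where x0: "x0 \<in> ?X" and y0: "y0 \<in> ?Y" by blast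
    have degX: "card {y\<in>?Y. skew x y} = card {y\<in>?Y. skew x0 y}" if "x \<in> ?X" for x
    proof -
      have m: "x0 \<in> M" "x \<in> M" "mate x0 a b \<longleftrightarrow> mate x a b" using x0 that by auto
      obtain \<sigma> where "\<sigma> permutes V - {a, b}" "relabel \<sigma> x0 = x"
        using transitive[OF m(1,2) ab(1,2) m(3)] .
      then show ?thesis using skew_degree_relabel[OF Y, of \<sigma> x0] by simp
    qed
    have degY: "card {x\<in>?X. skew x y} = card {x\<in>?X. skew x y0}" if "y \<in> ?Y" for y
    proof -
      have m: "y0 \<in> M" "y \<in> M" "mate y0 a b \<longleftrightarrow> mate y a b" using y0 that by auto
      obtain \<sigma> where "\<sigma> permutes V - {a, b}" "relabel \<sigma> y0 = y"
        using transitive[OF m(1,2) ab(1,2) m(3)] .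
      then show ?thesis using skew_degree_relabel[OF X, of \<sigma> y0]
        by (simp add: skew_sym[of _ y0] skew_sym[of _ y])
    qed
    have fin: "finite ?X" "finite ?Y" by auto
    have pos: "d > 0" if "m \<le> c * d" "m > 0" for m c d :: nat
      using that by (cases d) auto
    \<comment> \<open>Vertices on opposite sides never both have \<open>a\<close>, \<open>b\<close>
      together, as \<open>skew_fraction\<close> demands; so both degrees are positive.\<close>
    have "card ?Y \<le> skew_const k * card {y\<in>?Y. skew x0 y}"
      by (rule skew_fraction[OF _ Y]) (use x0 ab in auto)
    moreover have "card ?Y > 0" using y0 fin by (auto simp: card_gt_0_iff)
    ultimately have dX: "card {y\<in>?Y. skew x0 y} > 0" by (rule pos)
    have "card ?X \<le> skew_const k * card {x\<in>?X. skew y0 x}"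
      by (rule skew_fraction[OF _ X]) (use y0 ab in auto)
    moreover have "card ?X > 0" using x0 fin by (auto simp: card_gt_0_iff)
    ultimately have dY: "card {x\<in>?X. skew x y0} > 0"
      unfolding skew_sym[of _ y0] by (rule pos)
    show ?thesis
    proof (rule cross_independent_bound[where D = skew and p = ?p and q = ?p and I = ?I
        and dX = "card {y\<in>?Y. skew x0 y}" and dY = "card {x\<in>?X. skew x y0}"])
      show "0 < mixing_rate"
        using k2 n_large skew_const_pos by (simp add: mixing_rate_def)
      have move: "?p i x \<in> Z" if "stable a b Z" "i \<in> ?I" "x \<in> Z" for Z i x
      proof -
        have "fst i \<in> V - {a, b}" "snd i \<in> V - {a, b}" using that(2) by auto
        then show ?thesis using that(1,3) unfolding stable_def by blast
      qed
      show "?p i x \<in> ?X" if "i \<in> ?I" "x \<in> ?X" for i x by (rule move[OF X that])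
      show "?p i x \<in> ?Y" if "i \<in> ?I" "x \<in> ?Y" for i x by (rule move[OF Y that])
      show "?p i (?p i x) = x" "?p i (?p i x) = x" for i x by (rule relabel_transpose_twice)+
      show "skew (?p i x) y \<longleftrightarrow> skew x (?p i y)" for i x y by (rule skew_relabel_transpose)
      show "real (card {y \<in> ?Y. skew x y \<and> \<not> skew (?p i x) y})
        \<le> mixing_rate * card {y \<in> ?Y. skew x0 y}" if "i \<in> ?I" "x \<in> ?X" for i x
        unfolding degX[OF that(2), symmetric]
        by (rule stable_skew_move[OF _ Y ab(3)]) (use that in auto)
      show "real (card {x \<in> ?X. skew x y \<and> \<not> skew x (?p i y)})
        \<le> mixing_rate * card {x \<in> ?X. skew x y0}" if "i \<in> ?I" "y \<in> ?Y" for i y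
        unfolding degY[OF that(2), symmetric] skew_sym[of _ y] skew_sym[of _ "?p i y"]
        by (rule stable_skew_move[OF _ X ab(3)]) (use that in auto)
      show "(x, x') \<in> {(x, ?p i x) |x i. x \<in> ?X \<and> i \<in> ?I}\<^sup>*" if "x \<in> ?X" "x' \<in> ?X" for x x'
      proof -
        have m: "x \<in> M" "x' \<in> M" "mate x a b \<longleftrightarrow> mate x' a b" using that by auto
        obtain \<sigma> where \<sigma>: "\<sigma> permutes V - {a, b}" "relabel \<sigma> x = x'"
          using transitive[OF m(1,2) ab(1,2) m(3)] .
        from stable_connected[OF X \<sigma>(1) that(1)] show ?thesis unfolding \<sigma>(2) by (rule conjunct2)
      qed
    qed (use fin x0 degX degY dX dY f g inter in blast)+
  qed
qed

text \<open>A member with \<open>a\<close>, \<open>b\<close> apart would cost \<open>F\<close> the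
  fraction \<open>1 / skew_const k\<close> of the canonical family, while mixing bounds the number
  of all such members by less than that.\<close>

lemma extremal_is_star:
  assumes F: "F \<subseteq> M" and inter: "\<And>x y. x \<in> F \<Longrightarrow> y \<in> F \<Longrightarrow> \<not> skew x y"
    and large: "\<And>a b. a \<in> V \<Longrightarrow> b \<in> V \<Longrightarrow> a \<noteq> b \<Longrightarrow> card {y\<in>M. mate y a b} \<le> card F"
    and n: "256 * real k ^ 3 * real (skew_const k) ^ 4 * sqrt k * (ln (2 * n) * sqrt n / n) < 1"
    and ne: "M \<noteq> {}"
  shows "\<exists>a\<in>V. \<exists>b\<in>V. a \<noteq> b \<and> F = {y\<in>M. mate y a b}"
proof -
  have finF: "finite F" using F finite_M by (rule finite_subset)
  have "1 \<in> V" "2 \<in> V" using kn_large k2 n_large by auto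
  then have "card M \<le> 2 * n * card {y\<in>M. mate y 1 2}" "card {y\<in>M. mate y 1 2} \<le> card F"
    using card_M_le[of 1 2] large[of 1 2] by auto
  then have M_F: "card M \<le> 2 * n * card F" by (meson le_trans mult_le_mono2)
  have "card M > 0" using ne by (simp add: card_gt_0_iff)
  then have "F \<noteq> {}" using M_F by auto
  obtain a b where ab: "a \<in> V" "b \<in> V" "a \<noteq> b"
    and heavy: "card F \<le> heavy_factor * card {y\<in>F. mate y a b}"
    using heavy_pair[OF F \<open>F \<noteq> {}\<close> inter M_F] by blast
  define X where "X = {y\<in>M. mate y a b}"
  define f where "f = {y\<in>F. mate y a b}"
  define g where "g = {y\<in>F. \<not> mate y a b}"
  have finX: "finite X" by (simp add: X_def)
  have XF: "card X \<le> card F" unfolding X_def by (rule large[OF ab])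
  have fX: "f \<subseteq> X" using F by (auto simp: f_def X_def)
  have split: "card F = card f + card g"
  proof -
    have "F = f \<union> g" "f \<inter> g = {}" by (auto simp: f_def g_def)
    then show ?thesis using finF by (metis card_Un_disjoint finite_Un)
  qed
  have M_X: "card M \<le> 2 * n * card X" unfolding X_def by (rule card_M_le[OF ab])
  have cX: "real (card X) > 0" using M_X \<open>card M > 0\<close> by (cases "card X") auto
  define C where "C = real (skew_const k)"
  have C: "C > 0" using skew_const_pos by (simp add: C_def)
  have npos: "real n > 0" using n_large by simp
  have "g = {}"
  proof (rule ccontr)
    assume "g \<noteq> {}"
    then obtain x0 where x0: "x0 \<in> g" by blast
    have "card X \<le> skew_const k * card {y\<in>X. skew x0 y}"
      unfolding X_def by (rule skew_fraction[OF _ stable_together ab(3)]) (use x0 F in \<open>auto simp: g_def\<close>)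
    then have missing: "real (card X) \<le> C * card {y\<in>X. skew x0 y}"
      unfolding C_def by (metis of_nat_le_iff of_nat_mult)
    have "f \<subseteq> X - {y\<in>X. skew x0 y}" using fX inter x0 by (auto simp: f_def g_def)
    then have "card f \<le> card (X - {y\<in>X. skew x0 y})" using finX by (intro card_mono) auto
    also have "\<dots> = card X - card {y\<in>X. skew x0 y}" using finX by (intro card_Diff_subset) auto
    finally have f_le: "card f + card {y\<in>X. skew x0 y} \<le> card X"
      using card_mono[OF finX, of "{y\<in>X. skew x0 y}"] by auto
    have "real (card f) * card g \<le> mixing_rate\<^sup>2 * (card X * card {y\<in>M. \<not> mate y a b})"
      unfolding X_def
    proof (rule together_apart_bound[OF ab])
      show "\<not> skew x y" if "x \<in> f" "y \<in> g" for x y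
        using that inter[of x y] by (auto simp: f_def g_def)
    qed (use F in \<open>auto simp: f_def g_def\<close>)
    also have "\<dots> \<le> mixing_rate\<^sup>2 * real (card X * (2 * n * card X))"
    proof (intro mult_left_mono)
      have "card {y\<in>M. \<not> mate y a b} \<le> card M" by (intro card_mono) auto
      then have "card {y\<in>M. \<not> mate y a b} \<le> 2 * n * card X" using M_X by (rule le_trans)
      then show "real (card X * card {y\<in>M. \<not> mate y a b}) \<le> real (card X * (2 * n * card X))"
        unfolding of_nat_le_iff by (rule mult_le_mono2)
    qed simp
    finally have fg: "real (card f) * real (card g) \<le> mixing_rate\<^sup>2 * real (card X * (2 * n * card X))" .
    \<comment> \<open>As \<open>f\<close> is heavy,
      \<open>card X \<le> card F \<le> heavy_factor * card f\<close>, which lets one factor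
      \<open>card X\<close> cancel from the mixing bound.\<close>
    have "real (card X) * real (card g) \<le> heavy_factor * real (card f) * real (card g)"
      using XF heavy by (intro mult_right_mono) (auto simp: f_def)
    also have "\<dots> \<le> heavy_factor * (mixing_rate\<^sup>2 * real (card X * (2 * n * card X)))"
      unfolding mult.assoc[of heavy_factor] using fg heavy_factor_pos by (intro mult_left_mono) auto
    also have "\<dots> = real (card X) * (heavy_factor * mixing_rate\<^sup>2 * 2 * n * card X)" by simp
    finally have g_le: "real (card g) \<le> heavy_factor * mixing_rate\<^sup>2 * 2 * n * card X"
      by (rule mult_left_le_imp_le) (rule cX)
    \<comment> \<open>Orders of magnitude: \<open>heavy_factor\<close> contributes
      \<open>ln (2 * n) * sqrt n\<close>, the squared rate \<open>1 / n\<^sup>2\<close>, and the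
      size of the apart class relative to \<open>X\<close> a factor \<open>n\<close>.\<close>
    have id: "(8 * K * C * L * (sk * sn)) * (4 * K * C / N)\<^sup>2 * 2 * N * C
        = 256 * K ^ 3 * C ^ 4 * sk * (L * sn / N)" if "N \<noteq> 0" for K L sk sn N :: real
      using that by (simp add: field_simps power2_eq_square power3_eq_cube power4_eq_xxxx)
    have small: "heavy_factor * mixing_rate\<^sup>2 * 2 * n * C < 1"
    proof -
      have hf: "heavy_factor = 8 * real k * C * ln (2 * n) * (sqrt k * sqrt n)"
        by (simp add: heavy_factor_def C_def real_sqrt_mult)
      have mr: "mixing_rate = 4 * real k * C / real n"
        by (simp add: mixing_rate_def C_def)
      have "heavy_factor * mixing_rate\<^sup>2 * 2 * n * C
          = 256 * real k ^ 3 * C ^ 4 * sqrt k * (ln (2 * n) * sqrt n / n)"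
        unfolding hf mr by (rule id) (use npos in simp)
      then show ?thesis using n unfolding C_def by (rule ord_eq_less_trans)
    qed
    have "C * card g \<le> C * (heavy_factor * mixing_rate\<^sup>2 * 2 * n * card X)"
      using g_le C by (intro mult_left_mono) auto
    also have "\<dots> = (heavy_factor * mixing_rate\<^sup>2 * 2 * n * C) * card X" by simp
    also have "\<dots> < 1 * real (card X)" using small cX by (rule mult_strict_right_mono)
    finally have "C * card g < card X" by simp
    then have "C * card g < C * card {y\<in>X. skew x0 y}" using missing by (rule less_le_trans)
    then have "card g < card {y\<in>X. skew x0 y}" using C by simp
    \<comment> \<open>The members gained in \<open>g\<close> are fewer than those missing from
      \<open>X\<close>, so \<open>card F < card X\<close>, against maximality.\<close>
    then show False using f_le split XF by linarith
  qed
  then have "F \<subseteq> X" using F by (auto simp: g_def X_def)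
  then have "F = X" using finX XF by (intro card_subset_eq) (auto intro: antisym card_mono)
  then show ?thesis using ab unfolding X_def by blast
qed

lemma canonical_family_eq: "canonical_family k n a b = {y\<in>M. mate y a b}"
  by (auto simp: canonical_family_def mate_def)

end

section \<open>Choice of the threshold and comparison with canonical families\<close>

theorem theorem9p2:
  fixes k :: nat
  assumes "k \<ge> 2"
  shows "\<exists>N. \<forall>n\<ge>N. \<forall>F.
    partially_2_intersecting k n F \<and>
    (\<forall>G. partially_2_intersecting k n G \<longrightarrow> card G \<le> card F)
    \<longrightarrow> (\<exists>i\<in>{1..k * n}. \<exists>j\<in>{1..k * n}. i \<noteq> j \<and> F = canonical_family k n i j)"
proof -
  define c where "c = 256 * real k ^ 3 * real (skew_const k) ^ 4 * sqrt k"
  have "(\<lambda>n::nat. ln (2 * n) * sqrt n / n) \<longlonglongrightarrow> 0" by real_asymp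
  from tendsto_mult_left[OF this, of c] have "(\<lambda>n::nat. c * (ln (2 * n) * sqrt n / n)) \<longlonglongrightarrow> 0" by simp
  then have "\<forall>\<^sub>F n::nat in sequentially. c * (ln (2 * n) * sqrt n / n) < 1"
    by (rule order_tendstoD(2)) simp
  then have "\<exists>N::nat. \<forall>n\<ge>N. c * (ln (2 * real n) * sqrt (real n) / real n) < 1"
    by (simp only: eventually_sequentially)
  then obtain N :: nat where N: "\<forall>n\<ge>N. c * (ln (2 * real n) * sqrt (real n) / real n) < 1" by (rule exE)
  show ?thesis
  proof (intro exI[of _ "max N (4 * k + 4)"] allI impI, elim conjE)
    fix n F
    assume n: "max N (4 * k + 4) \<le> n" and F: "partially_2_intersecting k n F"
      and max: "\<forall>G. partially_2_intersecting k n G \<longrightarrow> card G \<le> card F"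
    interpret hypermatchings k n using assms n by unfold_locales auto
    have FM: "F \<subseteq> M" using F by (simp add: partially_2_intersecting_def)
    \<comment> \<open>Canonical families are themselves intersecting, hence competitors to which the
      maximality of \<open>F\<close> applies.\<close>
    have star: "partially_2_intersecting k n {y\<in>M. mate y a b}" if "a \<noteq> b" for a b
      unfolding partially_2_intersecting_def
    proof (intro conjI ballI)
      fix x y assume "x \<in> {y\<in>M. mate y a b}" "y \<in> {y\<in>M. mate y a b}"
      then show "partially_2_intersect x y"
        using that by (subst partially_2_intersect_iff) (auto simp: skew_def)
    qed auto
    show "\<exists>i\<in>V. \<exists>j\<in>V. i \<noteq> j \<and> F = canonical_family k n i j"
    proof (cases "M = {}")
      case True
      \<comment> \<open>If \<open>M\<close> is empty, so are \<open>F\<close> and every canonical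
        family, and any pair serves.\<close>
      have "1 \<in> V" "2 \<in> V" using kn_large k2 n_large by auto
      moreover have "F = canonical_family k n 1 2" using FM True by (auto simp: canonical_family_def)
      ultimately show ?thesis by (intro bexI[of _ 1] bexI[of _ 2]) auto
    next
      case False
      show ?thesis unfolding canonical_family_eq
      proof (rule extremal_is_star[OF FM])
        show "\<not> skew x y" if "x \<in> F" "y \<in> F" for x y
          using F FM that partially_2_intersect_iff[of x y] by (auto simp: partially_2_intersecting_def)
        show "card {y\<in>M. mate y a b} \<le> card F" if "a \<noteq> b" for a b using max star[OF that] by blast
        show "256 * real k ^ 3 * real (skew_const k) ^ 4 * sqrt k * (ln (2 * n) * sqrt n / n) < 1"
          using N[rule_format, of n] n unfolding c_def by simp
      qed (rule False)
    qed
  qed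
qed

end
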